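(* Let $q\ge2$ and let $Q_i$ be a sequence of $q$-ary quantum codes with length $n(Q_i)\to\infty$. Then \[ \limsup_{i\to\infty}\frac{d(Q_i)}{n(Q_i)}\le\frac12\Bigl(1-\frac1{q^2}\Bigr). \]
   Context: A $q$-ary quantum code of length $n$ and dimension $K$ is a $K$-dimensional subspace $Q\subseteq(\mathbb{C}^q)^{\otimes n}$, with orthogonal projection $P$. The weight of an operator on $(\mathbb{C}^q)^{\otimes n}$ that is a tensor product of single-qudit operators is the number of factors that are not scalar multiples of the identity. For $K\ge2$, the minimum distance $d(Q)$ is the largest $d$ such that $PEP$ is a scalar multiple of $P$ for every operator $E$ of weight $<d$ (and all linear combinations of such). For $K=1$, $Q=\mathrm{span}(\psi)$, $d(Q)$ is the largest $d$ such that $\langle\psi|E|\psi\rangle=q^{-n}\mathrm{tr}(E)$ for every operator $E$ of weight between $1$ and $d-1$. *)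

theory Defs
  imports
    "Jordan_Normal_Form.Schur_Decomposition"
    "Jordan_Normal_Form.VS_Connect"
    "HOL-Library.Extended_Real"
    "HOL-Library.Liminf_Limsup"
begin

text \<open>
  The space of \<open>n\<close> qudits, the \<open>n\<close>-fold tensor power of \<open>\<complex>\<^sup>q\<close>, is coordinatised as
  \<^term>\<open>carrier_vec (q ^ n) :: complex vec set\<close>: the index \<open>x < q ^ n\<close> stands for the basis tensor
  \<open>e\<^sub>a\<^sub>0 \<otimes> \<dots> \<otimes> e\<^sub>a\<^sub>m\<close> (\<open>m = n - 1\<close>) where \<open>a\<^sub>k\<close> is the \<open>k\<close>-th base-\<open>q\<close> digit of \<open>x\<close>.
\<close>

definition digit :: "nat \<Rightarrow> nat \<Rightarrow> nat \<Rightarrow> nat" where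
  "digit q k x = (x div q ^ k) mod q"

definition tensor_op :: "nat \<Rightarrow> nat \<Rightarrow> (nat \<Rightarrow> complex mat) \<Rightarrow> complex mat" where
  "tensor_op q n F =
     mat (q ^ n) (q ^ n) (\<lambda>(x, y). \<Prod>k<n. F k $$ (digit q k x, digit q k y))"

text \<open>
  The weight of a nonzero product operator does not depend on its factorisation; the zero operator
  has several weights, which is harmless because it satisfies all conditions below.
\<close>

definition ops_of_weight :: "nat \<Rightarrow> nat \<Rightarrow> nat \<Rightarrow> complex mat set" where
  "ops_of_weight q n w =
     {tensor_op q n F | F.
        (\<forall>k<n. F k \<in> carrier_mat q q) \<and>
        card {k. k < n \<and> \<not> (\<exists>c. F k = c \<cdot>\<^sub>m 1\<^sub>m q)} = w}"

definition mat_trace :: "complex mat \<Rightarrow> complex" where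
  "mat_trace A = (\<Sum>i<dim_row A. A $$ (i, i))"

definition is_orth_proj :: "nat \<Rightarrow> complex vec set \<Rightarrow> complex mat \<Rightarrow> bool" where
  "is_orth_proj N Q P \<longleftrightarrow>
     P \<in> carrier_mat N N \<and> P * P = P \<and> mat_adjoint P = P \<and>
     (\<lambda>v. P *\<^sub>v v) ` carrier_vec N = Q"

definition orth_proj :: "nat \<Rightarrow> complex vec set \<Rightarrow> complex mat" where
  "orth_proj N Q = (THE P. is_orth_proj N Q P)"

lemma adjoint_index:
  assumes "A \<in> carrier_mat n m" "i < m" "j < n"
  shows "mat_adjoint A $$ (i,j) = cnj (A $$ (j,i))"
  using assms unfolding mat_adjoint_def
  by (auto simp: mat_of_rows_def cols_def)

lemma adjoint_dim:
  assumes "A \<in> carrier_mat n m"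
  shows "mat_adjoint A \<in> carrier_mat m n"
  using assms unfolding mat_adjoint_def by (auto simp: mat_of_rows_def)

lemma adjoint_mult:
  fixes A B :: "complex mat"
  assumes A: "A \<in> carrier_mat n m" and B: "B \<in> carrier_mat m k"
  shows "mat_adjoint (A * B) = mat_adjoint B * mat_adjoint A"
proof (rule eq_matI)
  have AB: "A * B \<in> carrier_mat n k" using A B by auto
  note d = adjoint_dim[OF A] adjoint_dim[OF B] adjoint_dim[OF AB]
  show "dim_row (mat_adjoint (A * B)) = dim_row (mat_adjoint B * mat_adjoint A)"
    "dim_col (mat_adjoint (A * B)) = dim_col (mat_adjoint B * mat_adjoint A)" using d by auto
  fix i j assume "i < dim_row (mat_adjoint B * mat_adjoint A)" "j < dim_col (mat_adjoint B * mat_adjoint A)"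
  then have ij: "i < k" "j < n" using d by auto
  show "mat_adjoint (A * B) $$ (i, j) = (mat_adjoint B * mat_adjoint A) $$ (i, j)"
    unfolding adjoint_index[OF AB ij]
    using d A B ij by (auto simp: scalar_prod_def adjoint_index[OF A] adjoint_index[OF B] mult.commute intro!: sum.cong)
qed

lemma is_orth_proj_unique:
  assumes "is_orth_proj N Q P" "is_orth_proj N Q P'"
  shows "P = P'"
proof -
  have fx: "A * B = B" if "is_orth_proj N Q A" "is_orth_proj N Q B" for A B
  proof -
    have A: "A \<in> carrier_mat N N" "A * A = A" and B: "B \<in> carrier_mat N N"
      and im: "(\<lambda>v. A *\<^sub>v v) ` carrier_vec N = (\<lambda>v. B *\<^sub>v v) ` carrier_vec N"
      using that unfolding is_orth_proj_def by auto
    have "col (A * B) j = col B j" if j: "j < N" for j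
    proof -
      have "col B j = B *\<^sub>v unit_vec N j"
        using B j by (intro eq_vecI) (auto simp: mult_mat_vec_def)
      then have "col B j \<in> (\<lambda>v. A *\<^sub>v v) ` carrier_vec N" unfolding im by auto
      then obtain v where v: "v \<in> carrier_vec N" "col B j = A *\<^sub>v v" by auto
      have "col (A * B) j = A *\<^sub>v col B j" using A B j by auto
      also have "\<dots> = (A * A) *\<^sub>v v" unfolding v(2) using A(1) v(1) by (simp add: assoc_mult_mat_vec[OF A(1) A(1)])
      finally show ?thesis using A v by simp
    qed
    then show ?thesis using A B by (intro mat_col_eqI) auto
  qed
  have "P = mat_adjoint (P' * P)" using fx[OF assms(2,1)] assms unfolding is_orth_proj_def by simp
  also have "\<dots> = mat_adjoint P * mat_adjoint P'" using assms unfolding is_orth_proj_def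
    by (intro adjoint_mult) auto
  also have "\<dots> = P'" using fx[OF assms] assms unfolding is_orth_proj_def by simp
  finally show ?thesis .
qed

lemma orth_proj_exists:
  assumes Q: "VectorSpace.subspace class_ring Q (module_vec TYPE(complex) N)"
  shows "\<exists>P. is_orth_proj N Q P"
proof -
  interpret cof_vec_space N "TYPE(complex)" .
  have sm: "submodule class_ring Q V" using Q unfolding subspace_def by auto
  have QC: "Q \<subseteq> carrier_vec N" using submodule.subset[OF sm] by simp
  have "\<exists>B. finite B \<and> maximal B (\<lambda>B. B \<subseteq> Q \<and> lin_indpt B)"
  proof (rule maximal_exists[where B = "{}" and N = "dim"])
    show "finite A \<and> card A \<le> dim" if "A \<subseteq> Q \<and> lin_indpt A" for A
      using li_le_dim[of A] fin_dim that QC by auto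
    show "{} \<subseteq> Q \<and> lin_indpt {}" by (simp add: lin_dep_def)
  qed
  then obtain B where B: "finite B" "B \<subseteq> Q" "lin_indpt B"
    and mx: "\<And>A. A \<subseteq> Q \<Longrightarrow> lin_indpt A \<Longrightarrow> B \<subseteq> A \<Longrightarrow> A = B"
    unfolding maximal_def by auto
  have span: "span B = Q"
  proof
    show "span B \<subseteq> Q" using span_is_subset[OF B(2) sm] .
    show "Q \<subseteq> span B"
    proof
      fix v assume v: "v \<in> Q"
      show "v \<in> span B"
      proof (rule ccontr)
        assume nv: "v \<notin> span B"
        have BC: "B \<subseteq> carrier_vec N" and vC: "v \<in> carrier_vec N" using B QC v by auto
        have vB: "v \<notin> B" using nv span_mem[OF BC] by auto
        have "lin_indpt (insert v B)" 
          using lin_dep_iff_in_span[of B v] BC B vC vB nv by auto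
        then have "insert v B = B" using mx[of "insert v B"] v B by auto
        then show False using vB by auto
      qed
    qed
  qed
  obtain ws where ws: "set ws = B" "distinct ws" using finite_distinct_list[OF B(1)] by auto
  define us where "us = gram_schmidt N ws"
  have wsC: "set ws \<subseteq> carrier_vec N" using ws B QC by auto
  have us: "span (set us) = Q" "corthogonal us" "set us \<subseteq> carrier_vec N"
    using gram_schmidt_result[OF wsC ws(2) _ us_def] ws B span by auto
  define W where "W = mat_of_cols N us"
  define m where "m = length us"
  have W: "W \<in> carrier_mat N m" unfolding W_def m_def by auto
  define D where "D = mat m N (\<lambda>(i,j). cnj (W $$ (j,i)) / (us ! i \<bullet>c us ! i))"
  have D: "D \<in> carrier_mat m N" unfolding D_def by auto
  have usk: "us ! k \<in> carrier_vec N" if "k < m" for k using us(3) that unfolding m_def by auto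
  have ip: "us ! i \<bullet>c us ! j = (\<Sum>k<N. W $$ (k,i) * cnj (W $$ (k,j)))" if "i < m" "j < m" for i j
  proof -
    have "W $$ (k,i) = us ! i $ k" "W $$ (k,j) = us ! j $ k" if "k < N" for k
      using that \<open>i < m\<close> \<open>j < m\<close> unfolding W_def m_def by (auto simp: mat_of_cols_index)
    then show ?thesis using usk[OF that(1)] usk[OF that(2)]
      by (auto simp: scalar_prod_def lessThan_atLeast0 intro!: sum.cong)
  qed
  have nz: "us ! i \<bullet>c us ! i \<noteq> 0" if "i < m" for i
    using corthogonalD[OF us(2)] that unfolding m_def by blast
  have orth: "us ! i \<bullet>c us ! j = 0" if "i < m" "j < m" "i \<noteq> j" for i j
    using corthogonalD[OF us(2)] that unfolding m_def by blast
  have real: "cnj (us ! i \<bullet>c us ! i) = us ! i \<bullet>c us ! i" if "i < m" for i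
    unfolding ip[OF that that] by (simp add: mult.commute)
  have DW: "D * W = 1\<^sub>m m"
  proof (rule eq_matI)
    fix i j assume "i < dim_row (1\<^sub>m m :: complex mat)" "j < dim_col (1\<^sub>m m :: complex mat)"
    then have ij: "i < m" "j < m" by auto
    have "(D * W) $$ (i,j) = (\<Sum>k<N. cnj (W $$ (k,i)) / (us ! i \<bullet>c us ! i) * W $$ (k,j))"
      using ij W by (simp add: D_def scalar_prod_def lessThan_atLeast0)
    also have "\<dots> = (us ! j \<bullet>c us ! i) / (us ! i \<bullet>c us ! i)"
      unfolding ip[OF ij(2,1)] by (simp add: sum_divide_distrib mult.commute)
    also have "\<dots> = 1\<^sub>m m $$ (i,j)" using ij nz orth by auto
    finally show "(D * W) $$ (i,j) = 1\<^sub>m m $$ (i,j)" .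
  qed (use W D in auto)
  define P where "P = W * D"
  have P: "P \<in> carrier_mat N N" using W D unfolding P_def by auto
  have "P * P = W * (D * W) * D" unfolding P_def using W D
    by (smt (verit) assoc_mult_mat mult_carrier_mat)
  then have PP: "P * P = P" unfolding DW P_def using W by auto
  have adj: "mat_adjoint P = P"
  proof (rule eq_matI)
    fix i j assume "i < dim_row P" "j < dim_col P"
    then have ij: "i < N" "j < N" using P by auto
    have Pe: "P $$ (i,j) = (\<Sum>k<m. W $$ (i,k) * (cnj (W $$ (j,k)) / (us ! k \<bullet>c us ! k)))"
      if "i < N" "j < N" for i j
      using that W unfolding P_def D_def by (simp add: scalar_prod_def lessThan_atLeast0)
    show "mat_adjoint P $$ (i,j) = P $$ (i,j)"
      unfolding adjoint_index[OF P ij] Pe[OF ij] Pe[OF ij(2,1)] using real by (auto intro!: sum.cong)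
  qed (use P adjoint_dim[OF P] in auto)
  have Qeq: "Q = {y. \<exists>x\<in>carrier_vec m. W *\<^sub>v x = y}"
  proof -
    have "cols W = us" unfolding W_def using us(3) by (rule cols_mat_of_cols)
    then have "Q = col_space W" using us(1) unfolding col_space_def by simp
    then show ?thesis unfolding col_space_eq[OF W] using W by auto
  qed
  have "(\<lambda>v. P *\<^sub>v v) ` carrier_vec N = Q"
  proof (intro equalityI subsetI)
    fix y assume "y \<in> (\<lambda>v. P *\<^sub>v v) ` carrier_vec N"
    then obtain v where v: "v \<in> carrier_vec N" "y = P *\<^sub>v v" by auto
    have "y = W *\<^sub>v (D *\<^sub>v v)" unfolding v P_def using W D v by auto
    then show "y \<in> Q" unfolding Qeq using D v by auto
  next
    fix y assume "y \<in> Q"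
    then obtain x where x: "x \<in> carrier_vec m" "y = W *\<^sub>v x" unfolding Qeq by auto
    have "P *\<^sub>v y = W *\<^sub>v (D * W *\<^sub>v x)" unfolding x(2) P_def using W D x
      by (smt (verit) assoc_mult_mat_vec mult_mat_vec_carrier)
    then have "P *\<^sub>v y = y" unfolding DW using x by simp
    then show "y \<in> (\<lambda>v. P *\<^sub>v v) ` carrier_vec N" using x W by (metis image_eqI mult_mat_vec_carrier)
  qed
  then show ?thesis unfolding is_orth_proj_def using P PP adj by blast
qed

lemma is_orth_proj_orth_proj:
  assumes "VectorSpace.subspace class_ring Q (module_vec TYPE(complex) N)"
  shows "is_orth_proj N Q (orth_proj N Q)"
  unfolding orth_proj_def
  using orth_proj_exists[OF assms] is_orth_proj_unique by (metis theI)

definition code_dim :: "nat \<Rightarrow> nat \<Rightarrow> complex vec set \<Rightarrow> nat" where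
  "code_dim q n Q =
     vectorspace.dim class_ring ((module_vec TYPE(complex) (q ^ n))\<lparr>carrier := Q\<rparr>)"

definition quantum_code :: "nat \<Rightarrow> nat \<Rightarrow> nat \<Rightarrow> complex vec set \<Rightarrow> bool" where
  "quantum_code q n K Q \<longleftrightarrow>
     VectorSpace.subspace class_ring Q (module_vec TYPE(complex) (q ^ n)) \<and>
     code_dim q n Q = K \<and> K \<ge> 1"

definition detects_below :: "nat \<Rightarrow> nat \<Rightarrow> complex vec set \<Rightarrow> nat \<Rightarrow> bool" where
  "detects_below q n Q d \<longleftrightarrow>
     (let P = orth_proj (q ^ n) Q in
      \<forall>E \<in> LinearCombinations.module.span class_ring (module_mat TYPE(complex) (q ^ n) (q ^ n))
             (\<Union>w<d. ops_of_weight q n w).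
        \<exists>c. P * E * P = c \<cdot>\<^sub>m P)"

text \<open>
  For a one-dimensional code the unit vectors \<open>\<psi>\<close> differ only by a phase, so the following does not
  depend on \<open>\<psi>\<close>. As \<open>v \<bullet>c w\<close> conjugates \<open>w\<close>, the number \<open>\<langle>\<psi>|E|\<psi>\<rangle>\<close> is \<open>(E \<psi>) \<bullet>c \<psi>\<close>.
\<close>

definition uniform_below :: "nat \<Rightarrow> nat \<Rightarrow> complex vec set \<Rightarrow> nat \<Rightarrow> bool" where
  "uniform_below q n Q d \<longleftrightarrow>
     (\<forall>\<psi>\<in>Q. \<psi> \<bullet>c \<psi> = 1 \<longrightarrow>
       (\<forall>w. 1 \<le> w \<and> w < d \<longrightarrow>
         (\<forall>E\<in>ops_of_weight q n w. (E *\<^sub>v \<psi>) \<bullet>c \<psi> = mat_trace E / of_nat (q ^ n))))"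

text \<open>
  The maximum exists whenever \<open>q \<ge> 2\<close>, \<open>n \<ge> 1\<close> and the code is not zero: both conditions hold for
  \<open>d = 0\<close> and fail for \<open>d = n + 1\<close>, as every matrix unit has weight \<open>n\<close>.
\<close>

definition min_distance :: "nat \<Rightarrow> nat \<Rightarrow> complex vec set \<Rightarrow> nat" where
  "min_distance q n Q =
     (if code_dim q n Q \<ge> 2 then (GREATEST d. detects_below q n Q d)
      else (GREATEST d. uniform_below q n Q d))"

end

theory Submission
  imports Defs
begin

text \<open>
  Choose inside the code an orthonormal pair \<open>\<psi>\<^sub>0, \<psi>\<^sub>1\<close> (for \<open>K \<ge> 2\<close>) or a unit vector (for \<open>K = 1\<close>),
  with projection \<open>P\<close>, and put \<open>a(T) = \<Sum>|tr (E P)|\<^sup>2\<close> and \<open>b(T) = \<Sum>tr (E P E\<^sup>* P)\<close>, where \<open>E\<close> runs over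
  the Weyl operators supported in a set \<open>T\<close> of qudits. The quantum MacWilliams identity is
  \<open>q\<^sup>n b(T) = q\<^bsup>2|T|\<^esup> a(-T)\<close>, together with the same identity for \<open>a\<close> and \<open>b\<close> exchanged. It gives
  \<open>e(T) \<le> q\<^sup>2 e(T - {i})\<close> for \<open>e = a + b\<close>, because \<open>a\<close> and \<open>b\<close> are monotone.

  The detection conditions make the terms of \<open>c = b - a/2\<close> (of \<open>a\<close> without its identity term, if
  \<open>K = 1\<close>) vanish for operators of weight below \<open>d\<close>. Counting coordinates as in Plotkin's bound
  yields \<open>\<Sum>\<^sub>i c(T - {i}) \<le> (|T| - d) c(T)\<close>, so the average over \<open>i\<close> of the ratio \<open>c/e\<close> at \<open>T - {i}\<close> is at most
  \<open>q\<^sup>2 (|T| - d)/|T|\<close> times its value at \<open>T\<close>. If \<open>d/n\<close> exceeds \<open>(1 - 1/q\<^sup>2)/2\<close> by a constant, this factor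
  is at most \<open>1 - \<eta>\<close> for all \<open>|T| \<le> n/2 + O(1)\<close>, and boundedly many steps make the average ratio
  arbitrarily small at \<open>|T| \<approx> n/2\<close>. But the ratios at \<open>T\<close> and at its complement add up to at
  least \<open>1/4\<close>.
\<close>

subsection \<open>Averages over subsets\<close>

text \<open>Double counting of the pairs \<open>(T, i)\<close> with \<open>i\<close> in
  \<open>T\<close>: grouped by \<open>S = T - {i}\<close>, every \<open>S\<close> of size
  \<open>m\<close> arises from the \<open>n - m\<close> points outside it.\<close>

lemma sum_subsets_remove1:
  fixes g :: "nat set \<Rightarrow> real"
  assumes "m < n"
  shows "(\<Sum>T | T \<subseteq> {..<n} \<and> card T = Suc m. \<Sum>i\<in>T. g (T - {i})) =
    real (n - m) * (\<Sum>S | S \<subseteq> {..<n} \<and> card S = m. g S)"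
proof -
  have fin: "finite {T. T \<subseteq> {..<n} \<and> card T = k}" for k
    by (rule finite_subset[of _ "Pow {..<n}"]) auto
  have "(\<Sum>T | T \<subseteq> {..<n} \<and> card T = Suc m. \<Sum>i\<in>T. g (T - {i})) =
      (\<Sum>(T, i)\<in>(SIGMA T:{T. T \<subseteq> {..<n} \<and> card T = Suc m}. T). g (T - {i}))"
    by (rule sum.Sigma) (auto simp: fin intro: finite_subset)
  also have "\<dots> = (\<Sum>(S, i)\<in>(SIGMA S:{S. S \<subseteq> {..<n} \<and> card S = m}. {..<n} - S). g S)"
  proof (rule sum.reindex_bij_witness[where j = "\<lambda>(T, i). (T - {i}, i)" and i = "\<lambda>(S, i). (insert i S, i)"])
  qed (auto simp: card_insert_if finite_subset insert_absorb dest: finite_subset[OF _ finite_lessThan])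
  also have "\<dots> = (\<Sum>S | S \<subseteq> {..<n} \<and> card S = m. \<Sum>i\<in>{..<n} - S. g S)"
    by (rule sum.Sigma[symmetric]) (auto simp: fin)
  also have "\<dots> = (\<Sum>S | S \<subseteq> {..<n} \<and> card S = m. real (n - m) * g S)"
    by (intro sum.cong refl) (auto simp: card_Diff_subset finite_subset)
  finally show ?thesis by (simp add: sum_distrib_left)
qed

definition subset_avg :: "nat \<Rightarrow> (nat set \<Rightarrow> real) \<Rightarrow> nat \<Rightarrow> real" where
  "subset_avg n g m = (\<Sum>T | T \<subseteq> {..<n} \<and> card T = m. g T) / real (n choose m)"

lemma subset_avg_mono:
  assumes "m \<le> n" "\<And>T. T \<subseteq> {..<n} \<Longrightarrow> card T = m \<Longrightarrow> g T \<le> h T"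
  shows "subset_avg n g m \<le> subset_avg n h m"
  unfolding subset_avg_def using assms by (intro divide_right_mono sum_mono) auto

lemma subset_avg_const: "m \<le> n \<Longrightarrow> subset_avg n (\<lambda>_. c) m = c"
  unfolding subset_avg_def by (simp add: n_subsets)

text \<open>Removing a uniformly random point from a uniformly random set of size
  \<open>m + 1\<close> leaves a uniformly random set of size \<open>m\<close>. The normalisations
  agree because \<open>(m + 1) * (n choose (m + 1)) = (n - m) * (n choose m)\<close>.\<close>

lemma subset_avg_remove1:
  assumes "m < n"
  shows "subset_avg n (\<lambda>T. (\<Sum>i\<in>T. g (T - {i})) / real (card T)) (Suc m) = subset_avg n g m"
proof -
  have "Suc m * (n choose Suc m) = (n - m) * (n choose m)"
    using binomial_absorption[of m n] binomial_absorb_comp[of n m] by simp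
  then have *: "real (Suc m) * real (n choose Suc m) = real (n - m) * real (n choose m)"
    unfolding of_nat_mult[symmetric] by simp
  have "(\<Sum>T | T \<subseteq> {..<n} \<and> card T = Suc m. (\<Sum>i\<in>T. g (T - {i})) / real (card T)) =
      (\<Sum>T | T \<subseteq> {..<n} \<and> card T = Suc m. (\<Sum>i\<in>T. g (T - {i}))) / real (Suc m)"
    by (simp add: sum_divide_distrib)
  also have "\<dots> = real (n - m) * (\<Sum>S | S \<subseteq> {..<n} \<and> card S = m. g S) / real (Suc m)"
    unfolding sum_subsets_remove1[OF assms] ..
  finally have "subset_avg n (\<lambda>T. (\<Sum>i\<in>T. g (T - {i})) / real (card T)) (Suc m) =
      real (n - m) * (\<Sum>S | S \<subseteq> {..<n} \<and> card S = m. g S) /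
        (real (Suc m) * real (n choose Suc m))"
    unfolding subset_avg_def by simp
  also have "\<dots> = subset_avg n g m"
    unfolding * subset_avg_def using assms by simp
  finally show ?thesis .
qed

lemma subset_avg_compl:
  assumes "m \<le> n"
  shows "subset_avg n (\<lambda>T. g ({..<n} - T)) m = subset_avg n g (n - m)"
proof -
  have "(\<Sum>T | T \<subseteq> {..<n} \<and> card T = m. g ({..<n} - T)) =
      (\<Sum>T | T \<subseteq> {..<n} \<and> card T = n - m. g T)"
    using assms
    by (intro sum.reindex_bij_witness[where i = "\<lambda>T. {..<n} - T" and j = "\<lambda>T. {..<n} - T"])
       (auto simp: card_Diff_subset finite_subset)
  then show ?thesis unfolding subset_avg_def using binomial_symmetric[OF assms] by simp
qed

lemma subset_avg_add: "subset_avg n (\<lambda>T. g T + h T) m = subset_avg n g m + subset_avg n h m"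
  unfolding subset_avg_def by (simp add: sum.distrib add_divide_distrib)

lemma subset_avg_cmult: "subset_avg n (\<lambda>T. c * g T) m = c * subset_avg n g m"
  unfolding subset_avg_def by (simp add: sum_distrib_left)

text \<open>Isolates the averaging argument; \<open>Q\<close> stands for the square of the qudit
  dimension. The mean of \<open>c / e\<close> is at most 1 at size \<open>n div 2 + 1 + k\<close>
  and shrinks by \<open>1 - \<eta>\<close> with each point removed, so it is below 1/8 at size
  \<open>n div 2 + 1\<close>. It is no larger at the complementary size, whereas the two means add
  up to at least 1/4.\<close>

lemma subset_ratio_contradiction:
  fixes c e :: "nat set \<Rightarrow> real" and d \<eta> Q :: real
  assumes Q: "Q \<ge> 1" and eta: "0 < \<eta>" "\<eta> \<le> 1" and k: "(1 - \<eta>) ^ k < 1 / 8"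
    and len: "n div 2 + 1 + k \<le> n"
    and d: "(Q - 1 + \<eta>) * real (n div 2 + 1 + k) \<le> Q * d"
    and e: "\<And>T. T \<subseteq> {..<n} \<Longrightarrow> e T > 0"
    and c: "\<And>T. T \<subseteq> {..<n} \<Longrightarrow> 0 \<le> c T" "\<And>T. T \<subseteq> {..<n} \<Longrightarrow> c T \<le> e T"
    and erem: "\<And>T i. T \<subseteq> {..<n} \<Longrightarrow> i \<in> T \<Longrightarrow> e T \<le> Q * e (T - {i})"
    and crem: "\<And>T. T \<subseteq> {..<n} \<Longrightarrow> (\<Sum>i\<in>T. c (T - {i})) \<le> (real (card T) - d) * c T"
    and half: "\<And>T. T \<subseteq> {..<n} \<Longrightarrow> card T = n div 2 + 1 \<Longrightarrow>
      1 / 4 \<le> c T / e T + c ({..<n} - T) / e ({..<n} - T)"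
  shows False
proof -
  define \<theta> where "\<theta> T = c T / e T" for T
  define A where "A = subset_avg n \<theta>"
  let ?m = "n div 2 + 1"
  \<comment> \<open>\<open>erem\<close> replaces every denominator \<open>e (T - {i})\<close> by
    \<open>e T / Q\<close>, after which all summands share one denominator and \<open>crem\<close>
    applies to the numerators.\<close>
  have rem: "(\<Sum>i\<in>T. \<theta> (T - {i})) / real (card T) \<le> (1 - \<eta>) * \<theta> T"
    if T: "T \<subseteq> {..<n}" "card T \<le> ?m + k" "card T > 0" for T
  proof -
    have "\<theta> (T - {i}) \<le> Q * c (T - {i}) / e T" if "i \<in> T" for i
    proof -
      have *: "e (T - {i}) > 0" "e T > 0" "0 \<le> c (T - {i})"
        using T e c by (meson Diff_subset order_trans)+
      have "c (T - {i}) * e T \<le> c (T - {i}) * (Q * e (T - {i}))"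
        using * erem[OF T(1) that] by (intro mult_left_mono) auto
      then show ?thesis unfolding \<theta>_def using * by (simp add: field_simps)
    qed
    then have "(\<Sum>i\<in>T. \<theta> (T - {i})) \<le> (\<Sum>i\<in>T. Q * c (T - {i}) / e T)" by (rule sum_mono)
    also have "\<dots> = Q * (\<Sum>i\<in>T. c (T - {i})) / e T"
      by (simp add: sum_divide_distrib sum_distrib_left)
    also have "\<dots> \<le> Q * ((real (card T) - d) * c T) / e T"
      using crem[OF T(1)] e[OF T(1)] Q by (intro divide_right_mono mult_left_mono) auto
    also have "\<dots> = (Q * real (card T) - Q * d) * \<theta> T"
      by (simp add: \<theta>_def left_diff_distrib right_diff_distrib mult.assoc)
    also have "\<dots> \<le> ((1 - \<eta>) * real (card T)) * \<theta> T"
    proof (rule mult_right_mono)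
      \<comment> \<open>The hypothesis on \<open>d\<close> concerns the largest size
        \<open>?m + k\<close>. As its left side increases with the size, it covers all smaller
        \<open>T\<close>.\<close>
      have "(Q - 1 + \<eta>) * real (card T) \<le> (Q - 1 + \<eta>) * real (?m + k)"
        using T Q eta by (intro mult_left_mono) auto
      then show "Q * real (card T) - Q * d \<le> (1 - \<eta>) * real (card T)"
        using d by (simp add: algebra_simps)
      show "0 \<le> \<theta> T" unfolding \<theta>_def using c e T by (simp add: less_imp_le)
    qed
    finally show ?thesis using T by (simp add: field_simps)
  qed
  have contract: "A j \<le> (1 - \<eta>) * A (Suc j)" if "j < ?m + k" for j
  proof -
    have j: "j < n" using that len by simp
    have "A j = subset_avg n (\<lambda>T. (\<Sum>i\<in>T. \<theta> (T - {i})) / real (card T)) (Suc j)"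
      unfolding A_def using subset_avg_remove1[OF j] by simp
    also have "\<dots> \<le> subset_avg n (\<lambda>T. (1 - \<eta>) * \<theta> T) (Suc j)"
      using that j by (intro subset_avg_mono rem) auto
    finally show ?thesis by (simp add: A_def subset_avg_cmult)
  qed
  have A0: "0 \<le> A j" if "j \<le> n" for j
    using subset_avg_mono[of j n "\<lambda>_. 0" \<theta>] subset_avg_const[of j n 0] that c e
    unfolding A_def \<theta>_def by (simp add: less_imp_le)
  have A1: "A j \<le> 1" if "j \<le> n" for j
    using subset_avg_mono[of j n \<theta> "\<lambda>_. 1"] subset_avg_const[of j n 1] that c e
    unfolding A_def \<theta>_def by (simp add: divide_le_eq_1)
  have pow: "A ?m \<le> (1 - \<eta>) ^ j * A (?m + j)" if "j \<le> k" for j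
    using that
  proof (induction j)
    case (Suc j)
    have "(1 - \<eta>) ^ j * A (?m + j) \<le> (1 - \<eta>) ^ j * ((1 - \<eta>) * A (Suc (?m + j)))"
      using Suc.prems eta by (intro mult_left_mono contract) auto
    then show ?case using Suc by (simp add: mult_ac)
  qed simp
  have "A ?m \<le> (1 - \<eta>) ^ k * A (?m + k)" by (rule pow) simp
  also have "\<dots> \<le> (1 - \<eta>) ^ k * 1" using eta len by (intro mult_left_mono A1) auto
  finally have small: "A ?m < 1 / 8" using k by simp
  \<comment> \<open>The complement of a set of size \<open>?m\<close> has size
    \<open>n - ?m\<close>, which is at most \<open>?m\<close>, so contraction is also needed below
    \<open>?m\<close>.\<close>
  have mono: "A j \<le> A ?m" if "j \<le> ?m" for j
    using that
  proof (induction rule: inc_induct)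
    case (step j)
    have "A j \<le> (1 - \<eta>) * A (Suc j)" using step.hyps by (intro contract) simp
    also have "\<dots> \<le> 1 * A (Suc j)"
      using eta step.hyps len by (intro mult_right_mono A0) auto
    finally show ?case using step.IH by simp
  qed simp
  have "1 / 4 = subset_avg n (\<lambda>_. 1 / 4) ?m" using len by (simp add: subset_avg_const)
  also have "\<dots> \<le> subset_avg n (\<lambda>T. \<theta> T + \<theta> ({..<n} - T)) ?m"
    using len half unfolding \<theta>_def by (intro subset_avg_mono) auto
  also have "\<dots> = A ?m + A (n - ?m)"
    using len subset_avg_compl[of ?m n \<theta>] by (simp add: subset_avg_add A_def)
  also have "A (n - ?m) \<le> A ?m" by (rule mono) simp
  finally show False using small by simp
qed

subsection \<open>Weyl operators and the MacWilliams identity\<close>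

text \<open>A geometric sum with ratio \<open>z = cis (2 * pi * t / q)\<close>: here
  \<open>z ^ q = 1\<close>, and \<open>z = 1\<close> would force \<open>q\<close> to divide
  \<open>t\<close>.\<close>

lemma sum_roots_of_unity:
  fixes t :: int
  assumes "q > 0" "\<not> int q dvd t"
  shows "(\<Sum>b<q. cis (2 * pi * (real b * of_int t) / real q)) = 0"
proof -
  define z where "z = cis (2 * pi * of_int t / real q)"
  have "z \<noteq> 1"
  proof
    assume "z = 1"
    then have "cos (2 * pi * of_int t / real q) = 1"
      by (simp add: z_def complex_eq_iff)
    then obtain k :: int where "2 * pi * of_int t / real q = of_int k * 2 * pi"
      unfolding cos_one_2pi_int by auto
    then have "of_int t = (of_int (int q * k) :: real)"
      using assms(1) by (simp add: field_simps)
    then have "t = int q * k" by (simp only: of_int_eq_iff)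
    then show False using assms(2) by simp
  qed
  have "z ^ q = cis (2 * pi * of_int t)"
    using assms(1) by (simp add: z_def DeMoivre)
  also have "\<dots> = 1" by (rule cis_multiple_2pi) simp
  finally have "(\<Sum>b<q. z ^ b) = 0" using \<open>z \<noteq> 1\<close> by (simp add: geometric_sum)
  then show ?thesis by (simp add: z_def DeMoivre mult_ac)
qed

text \<open>For \<open>l = (a, b)\<close> this is the entry \<open>(i, j)\<close> of the operator
  X^a Z^b, where X is the cyclic shift and Z the diagonal matrix of the powers of a primitive
  \<open>q\<close>-th root of unity.\<close>

definition weyl :: "nat \<Rightarrow> nat \<times> nat \<Rightarrow> nat \<Rightarrow> nat \<Rightarrow> complex" where
  "weyl q l i j =
     (if i = (j + fst l) mod q then cis (2 * pi * real (snd l * j) / real q) else 0)"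

text \<open>Solves for the shift; adding \<open>q\<close> keeps the subtraction on naturals from
  truncating.\<close>

lemma shift_mod_eq_iff:
  fixes i j a q :: nat
  assumes "i < q" "j < q" "a < q"
  shows "i = (j + a) mod q \<longleftrightarrow> a = (i + q - j) mod q"
proof (cases "j + a < q")
  case True
  then show ?thesis using assms by (cases "j \<le> i") (auto simp: mod_if)
next
  case False
  then have "(j + a) mod q = j + a - q" using assms by (simp add: mod_if)
  then show ?thesis using assms False by (cases "j \<le> i") (auto simp: mod_if)
qed

text \<open>Completeness of the Weyl basis. Summing over the phase label leaves only
  \<open>j = j'\<close>, by orthogonality of characters; then exactly one shift carries
  \<open>j\<close> to \<open>i\<close>, and it must carry \<open>j'\<close> to \<open>i'\<close>
  too.\<close>

lemma weyl_complete:
  assumes "i < q" "j < q" "i' < q" "j' < q"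
  shows "(\<Sum>l\<in>{..<q} \<times> {..<q}. weyl q l i j * cnj (weyl q l i' j')) =
    (if i = i' \<and> j = j' then of_nat q else 0)"
proof -
  have q: "q > 0" using assms by simp
  define g where "g b = cis (2 * pi * (real b * of_int (int j - int j')) / real q)" for b
  have ph: "cis (2 * pi * real (b * j) / real q) * cnj (cis (2 * pi * real (b * j') / real q)) =
      g b" for b
    by (simp add: g_def cis_cnj cis_mult diff_divide_distrib right_diff_distrib mult_ac)
  have "(\<Sum>l\<in>{..<q} \<times> {..<q}. weyl q l i j * cnj (weyl q l i' j')) =
      (\<Sum>a<q. \<Sum>b<q. weyl q (a, b) i j * cnj (weyl q (a, b) i' j'))"
    by (simp add: sum.cartesian_product)
  also have "\<dots> = (\<Sum>a<q. if i = (j + a) mod q \<and> i' = (j' + a) mod q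
      then \<Sum>b<q. g b else 0)"
    by (intro sum.cong refl) (auto simp: weyl_def ph[symmetric])
  also have "\<dots> = (if i = i' \<and> j = j' then of_nat q else 0)"
  proof (cases "j = j'")
    case True
    have "(\<Sum>a<q. if i = (j + a) mod q \<and> i' = (j' + a) mod q
        then \<Sum>b<q. g b else 0) =
        (\<Sum>a<q. if a = (i + q - j) mod q then if i = i' then of_nat q else 0 else 0)"
      using True assms by (intro sum.cong refl) (auto simp: g_def shift_mod_eq_iff[symmetric])
    then show ?thesis using True q by simp
  next
    case False
    have "\<not> int q dvd int j - int j'"
      using False assms zdvd_not_zless[of "\<bar>int j - int j'\<bar>" "int q"] by auto
    then show ?thesis using False sum_roots_of_unity[OF q, of "int j - int j'"]
      unfolding g_def by simp
  qed
  finally show ?thesis .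
qed

lemma weyl_0: "j < q \<Longrightarrow> weyl q (0, 0) i j = (if i = j then 1 else 0)"
  by (auto simp: weyl_def)

text \<open>A nonzero shift has an empty diagonal; for shift 0 the trace is a full sum of a
  nontrivial character.\<close>

lemma weyl_trace:
  assumes "a < q" "b < q" "(a, b) \<noteq> (0, 0)"
  shows "(\<Sum>i<q. weyl q (a, b) i i) = 0"
proof (cases "a = 0")
  case True
  then have "\<not> int q dvd int b" using assms by (auto simp: zdvd_not_zless)
  then have "(\<Sum>i<q. cis (2 * pi * (real i * of_int (int b)) / real q)) = 0"
    using assms by (intro sum_roots_of_unity) auto
  then show ?thesis using True by (simp add: weyl_def mult_ac)
next
  case False
  have "i \<noteq> (i + a) mod q" if "i < q" for i
    using shift_mod_eq_iff[OF that that assms(1)] False assms by auto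
  then show ?thesis by (auto simp: weyl_def intro!: sum.neutral)
qed

section \<open>Weyl operators on \<open>n\<close> qudits and the MacWilliams exchange\<close>

definition weyl_op :: "nat \<Rightarrow> nat \<Rightarrow> (nat \<Rightarrow> nat \<times> nat) \<Rightarrow> nat \<Rightarrow> nat \<Rightarrow> complex" where
  "weyl_op q n f x y = (\<Prod>k<n. weyl q (f k) (digit q k x) (digit q k y))"

text \<open>Sites outside \<open>T\<close> are forced to carry the identity label instead of being
  left out. Thus the labels for all \<open>T\<close> lie in one common set, and sums over them
  factor site by site.\<close>

definition labels :: "nat \<Rightarrow> nat \<Rightarrow> nat set \<Rightarrow> (nat \<Rightarrow> nat \<times> nat) set" where
  "labels q n T = PiE {..<n} (\<lambda>k. if k \<in> T then {..<q} \<times> {..<q} else {(0, 0)})"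

definition supp :: "nat \<Rightarrow> (nat \<Rightarrow> nat \<times> nat) \<Rightarrow> nat set" where
  "supp n f = {k. k < n \<and> f k \<noteq> (0, 0)}"

lemma finite_labels: "finite (labels q n T)"
  unfolding labels_def by (intro finite_PiE) auto

lemma labels_iff:
  assumes "q > 0" "T \<subseteq> {..<n}"
  shows "f \<in> labels q n T \<longleftrightarrow> f \<in> labels q n {..<n} \<and> supp n f \<subseteq> T"
proof -
  have "f k \<in> (if k \<in> T then {..<q} \<times> {..<q} else {(0, 0)}) \<longleftrightarrow>
      f k \<in> {..<q} \<times> {..<q} \<and> (f k \<noteq> (0, 0) \<longrightarrow> k \<in> T)" for k
    using assms(1) by (cases "f k") auto
  then show ?thesis unfolding labels_def supp_def PiE_iff by auto
qed

lemma digit_less: "q > 0 \<Longrightarrow> digit q k x < q"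
  by (simp add: digit_def)

text \<open>Each site contributes one of two pairings of the four indices: \<open>x\<close> with
  \<open>v\<close> and \<open>y\<close> with \<open>u\<close> inside \<open>T\<close>,
  \<open>x\<close> with \<open>y\<close> and \<open>v\<close> with \<open>u\<close> outside.
  Swapping \<open>y\<close> and \<open>v\<close> interchanges the two pairings.\<close>

definition ind_kernel :: "nat \<Rightarrow> nat \<Rightarrow> nat set \<Rightarrow> nat \<Rightarrow> nat \<Rightarrow> nat \<Rightarrow> nat \<Rightarrow> complex" where
  "ind_kernel q n T x y v u = (\<Prod>k<n. of_bool (
     if k \<in> T then digit q k x = digit q k v \<and> digit q k y = digit q k u
     else digit q k x = digit q k y \<and> digit q k v = digit q k u))"

text \<open>The sum of products over labels is a product over sites of sums over single labels. A
  site in \<open>T\<close> gives \<open>q\<close> times a delta by \<open>weyl_complete\<close>; any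
  other site has only the identity.\<close>

lemma weyl_op_kernel:
  assumes q: "q > 0" and T: "T \<subseteq> {..<n}"
  shows "(\<Sum>f\<in>labels q n T. weyl_op q n f x y * cnj (weyl_op q n f v u)) =
    of_nat (q ^ card T) * ind_kernel q n T x y v u"
proof -
  have "(\<Sum>f\<in>labels q n T. weyl_op q n f x y * cnj (weyl_op q n f v u)) =
      (\<Sum>f\<in>labels q n T. \<Prod>k<n. weyl q (f k) (digit q k x) (digit q k y) *
        cnj (weyl q (f k) (digit q k v) (digit q k u)))"
    by (simp add: weyl_op_def prod.distrib)
  also have "\<dots> = (\<Prod>k<n. \<Sum>l\<in>(if k \<in> T then {..<q} \<times> {..<q} else {(0, 0)}).
      weyl q l (digit q k x) (digit q k y) * cnj (weyl q l (digit q k v) (digit q k u)))"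
    unfolding labels_def by (rule prod_sum_PiE[symmetric]) auto
  also have "\<dots> = (\<Prod>k<n. (if k \<in> T then of_nat q else 1) * of_bool (
     if k \<in> T then digit q k x = digit q k v \<and> digit q k y = digit q k u
     else digit q k x = digit q k y \<and> digit q k v = digit q k u))"
    using q by (intro prod.cong refl) (auto simp: weyl_complete weyl_0 digit_less)
  also have "\<dots> = (\<Prod>k<n. if k \<in> T then of_nat q else 1) * ind_kernel q n T x y v u"
    unfolding ind_kernel_def by (rule prod.distrib)
  also have "(\<Prod>k<n. if k \<in> T then of_nat q else 1 :: complex) = of_nat (q ^ card T)"
    using T by (simp add: prod.If_cases Int_absorb1 Int_absorb2)
  finally show ?thesis .
qed

text \<open>The matrix element of the Weyl operator \<open>f\<close> between the vectors \<alpha>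
  (conjugated) and \<beta>. Vectors are coordinate functions, of which only the values below
  \<open>q ^ n\<close> are used.\<close>

definition braket ::
  "nat \<Rightarrow> nat \<Rightarrow> (nat \<Rightarrow> complex) \<Rightarrow> (nat \<Rightarrow> complex) \<Rightarrow> (nat \<Rightarrow> nat \<times> nat) \<Rightarrow> complex" where
  "braket q n \<alpha> \<beta> f = (\<Sum>x<q ^ n. \<Sum>y<q ^ n. cnj (\<alpha> x) * weyl_op q n f x y * \<beta> y)"

lemma braket_sum_kernel:
  assumes q: "q > 0" and T: "T \<subseteq> {..<n}"
  shows "(\<Sum>f\<in>labels q n T. braket q n \<alpha> \<beta> f * cnj (braket q n \<gamma> \<delta> f)) =
    of_nat (q ^ card T) * (\<Sum>x<q ^ n. \<Sum>y<q ^ n. \<Sum>v<q ^ n. \<Sum>u<q ^ n.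
      cnj (\<alpha> x) * \<beta> y * \<gamma> v * cnj (\<delta> u) * ind_kernel q n T x y v u)"
proof -
  have "(\<Sum>f\<in>labels q n T. braket q n \<alpha> \<beta> f * cnj (braket q n \<gamma> \<delta> f)) =
      (\<Sum>f\<in>labels q n T. \<Sum>x<q ^ n. \<Sum>y<q ^ n. \<Sum>v<q ^ n. \<Sum>u<q ^ n.
        cnj (\<alpha> x) * \<beta> y * \<gamma> v * cnj (\<delta> u) * (weyl_op q n f x y * cnj (weyl_op q n f v u)))"
    unfolding braket_def sum_distrib_right cnj_sum
    unfolding sum_distrib_left by (intro sum.cong refl) (simp add: mult_ac)
  also have "\<dots> = (\<Sum>x<q ^ n. \<Sum>y<q ^ n. \<Sum>v<q ^ n. \<Sum>u<q ^ n. \<Sum>f\<in>labels q n T.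
        cnj (\<alpha> x) * \<beta> y * \<gamma> v * cnj (\<delta> u) * (weyl_op q n f x y * cnj (weyl_op q n f v u)))"
    by (subst sum.swap, intro sum.cong refl)+
  also have "\<dots> = (\<Sum>x<q ^ n. \<Sum>y<q ^ n. \<Sum>v<q ^ n. \<Sum>u<q ^ n.
        cnj (\<alpha> x) * \<beta> y * \<gamma> v * cnj (\<delta> u) * (of_nat (q ^ card T) * ind_kernel q n T x y v u))"
    unfolding sum_distrib_left[symmetric] weyl_op_kernel[OF q T] ..
  finally show ?thesis by (simp add: sum_distrib_left mult_ac)
qed

text \<open>
  Exchanging the indices \<open>y\<close> and \<open>v\<close> turns the kernel of \<open>T\<close> into that of its complement;
  this is the quantum MacWilliams identity in the form that involves only products over subsets.
\<close>

lemma braket_macwilliams: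
  assumes q: "q > 0" and T: "T \<subseteq> {..<n}"
  shows "of_nat (q ^ n) * (\<Sum>f\<in>labels q n T. braket q n \<alpha> \<beta> f * cnj (braket q n \<gamma> \<delta> f)) =
    of_nat (q ^ (2 * card T)) *
      (\<Sum>f\<in>labels q n ({..<n} - T). braket q n \<alpha> \<gamma> f * cnj (braket q n \<beta> \<delta> f))"
proof -
  have ker: "ind_kernel q n ({..<n} - T) x v y u = ind_kernel q n T x y v u" for x y v u
    unfolding ind_kernel_def by (intro prod.cong refl) auto
  have "card T \<le> n" using card_mono[OF _ T] by simp
  moreover have "card ({..<n} - T) = n - card T"
    using T by (simp add: card_Diff_subset finite_subset)
  \<comment> \<open>The exponents match since
    \<open>2 * card T + (n - card T) = n + card T\<close>.\<close>
  ultimately have pow: "q ^ (2 * card T) * q ^ card ({..<n} - T) = q ^ n * q ^ card T"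
    by (simp add: power_add[symmetric] add.commute)
  have "(\<Sum>x<q ^ n. \<Sum>y<q ^ n. \<Sum>v<q ^ n. \<Sum>u<q ^ n.
      cnj (\<alpha> x) * \<gamma> y * \<beta> v * cnj (\<delta> u) * ind_kernel q n ({..<n} - T) x y v u) =
    (\<Sum>x<q ^ n. \<Sum>y<q ^ n. \<Sum>v<q ^ n. \<Sum>u<q ^ n.
      cnj (\<alpha> x) * \<beta> y * \<gamma> v * cnj (\<delta> u) * ind_kernel q n T x y v u)"
    by (rule sum.cong[OF refl], subst sum.swap) (simp add: ker mult_ac)
  then show ?thesis
    unfolding braket_sum_kernel[OF q T] braket_sum_kernel[OF q Diff_subset]
    by (simp only: mult.assoc[symmetric] of_nat_mult[symmetric] pow)
qed

section \<open>Plotkin counting and abstract enumerators\<close>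

text \<open>A label \<open>f\<close> supported in \<open>T\<close> survives the removal of
  \<open>i\<close> exactly when \<open>i\<close> is outside its support, hence is counted
  \<open>card T - card (supp n f)\<close> times. This is at most \<open>card T - d\<close> unless
  the support is smaller than \<open>d\<close>, and then \<open>c f = 0\<close>.\<close>

lemma sum_labels_remove1:
  fixes c :: "(nat \<Rightarrow> nat \<times> nat) \<Rightarrow> real"
  assumes q: "q > 0" and T: "T \<subseteq> {..<n}"
    and c: "\<And>f. f \<in> labels q n {..<n} \<Longrightarrow> 0 \<le> c f"
    and d: "\<And>f. f \<in> labels q n {..<n} \<Longrightarrow> card (supp n f) < d \<Longrightarrow> c f = 0"
  shows "(\<Sum>i\<in>T. sum c (labels q n (T - {i}))) \<le> (real (card T) - real d) * sum c (labels q n T)"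
proof -
  have finT: "finite T" using T by (rule finite_subset) simp
  have "(\<Sum>i\<in>T. sum c (labels q n (T - {i}))) =
      (\<Sum>i\<in>T. \<Sum>f\<in>labels q n T. if i \<notin> supp n f then c f else 0)"
  proof (rule sum.cong[OF refl])
    fix i assume "i \<in> T"
    have "T - {i} \<subseteq> {..<n}" using T by auto
    then have "labels q n (T - {i}) = {f \<in> labels q n T. i \<notin> supp n f}"
      using labels_iff[OF q, of "T - {i}"] labels_iff[OF q T] by auto
    then show "sum c (labels q n (T - {i})) =
        (\<Sum>f\<in>labels q n T. if i \<notin> supp n f then c f else 0)"
      by (simp add: sum.inter_filter finite_labels)
  qed
  also have "\<dots> = (\<Sum>f\<in>labels q n T. \<Sum>i\<in>T. if i \<notin> supp n f then c f else 0)"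
    by (rule sum.swap)
  also have "\<dots> \<le> (\<Sum>f\<in>labels q n T. (real (card T) - real d) * c f)"
  proof (rule sum_mono)
    fix f assume "f \<in> labels q n T"
    then have f: "f \<in> labels q n {..<n}" "supp n f \<subseteq> T" using labels_iff[OF q T] by auto
    have "(\<Sum>i\<in>T. if i \<notin> supp n f then c f else 0) = real (card (T - supp n f)) * c f"
      using finT by (simp add: sum.inter_filter[symmetric] set_diff_eq)
    also have "real (card (T - supp n f)) = real (card T) - real (card (supp n f))"
      using f finT by (simp add: card_Diff_subset finite_subset card_mono of_nat_diff)
    also have "(real (card T) - real (card (supp n f))) * c f \<le> (real (card T) - real d) * c f"
      using d[OF f(1)] c[OF f(1)] by (cases "card (supp n f) < d") (auto intro!: mult_right_mono)
    finally show "(\<Sum>i\<in>T. if i \<notin> supp n f then c f else 0) \<le> (real (card T) - real d) * c f" .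
  qed
  finally show ?thesis by (simp add: sum_distrib_left)
qed

text \<open>The common core of the cases \<open>K = 1\<close> and \<open>K \<ge> 2\<close>, which
  differ only in the choice of \<open>a\<close>, \<open>b\<close>, \<open>c\<close>. The hypothesis
  \<open>half\<close> is the ratio inequality at \<open>T\<close> and its complement, with
  denominators cleared by the MacWilliams identities.\<close>

lemma enumerator_contradiction:
  fixes a b c :: "(nat \<Rightarrow> nat \<times> nat) \<Rightarrow> real" and \<eta> :: real and q n d k :: nat
  defines "A \<equiv> \<lambda>T. sum a (labels q n T)" and "B \<equiv> \<lambda>T. sum b (labels q n T)"
    and "C \<equiv> \<lambda>T. sum c (labels q n T)"
  assumes q: "q > 0" and eta: "0 < \<eta>" "\<eta> \<le> 1" and k: "(1 - \<eta>) ^ k < 1 / 8"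
    and len: "n div 2 + 1 + k \<le> n"
    and dist: "((real q)\<^sup>2 - 1 + \<eta>) * real (n div 2 + 1 + k) \<le> (real q)\<^sup>2 * real d"
    and nonneg: "\<And>f. 0 \<le> a f" "\<And>f. 0 \<le> b f"
    and c: "\<And>f. f \<in> labels q n {..<n} \<Longrightarrow> 0 \<le> c f"
      "\<And>f. f \<in> labels q n {..<n} \<Longrightarrow> c f \<le> a f + b f"
      "\<And>f. f \<in> labels q n {..<n} \<Longrightarrow> card (supp n f) < d \<Longrightarrow> c f = 0"
    and pos: "A {} > 0"
    and mac: "\<And>T. T \<subseteq> {..<n} \<Longrightarrow> real q ^ n * B T = real q ^ (2 * card T) * A ({..<n} - T)"
    and mac': "\<And>T. T \<subseteq> {..<n} \<Longrightarrow> real q ^ n * A T = real q ^ (2 * card T) * B ({..<n} - T)"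
    and half: "\<And>T. T \<subseteq> {..<n} \<Longrightarrow> card T = n div 2 + 1 \<Longrightarrow>
      real q ^ n * (A T + B T) \<le> 4 * (real q ^ n * C T + real q ^ (2 * card T) * C ({..<n} - T))"
  shows False
proof -
  have rq: "real q > 0" "real q \<ge> 1" using q by auto
  have sub: "labels q n S \<subseteq> labels q n T" if "S \<subseteq> T" "T \<subseteq> {..<n}" for S T
    using labels_iff[OF q order_trans[OF that]] labels_iff[OF q that(2)] that by blast
  have Amono: "A S \<le> A T" and Bmono: "B S \<le> B T" if "S \<subseteq> T" "T \<subseteq> {..<n}" for S T
    unfolding A_def B_def using sub[OF that] nonneg by (auto intro!: sum_mono2 finite_labels)
  \<comment> \<open>Passing to the complement turns the removal of \<open>i\<close> into an
    enlargement, where the other enumerator is monotone; only the prefactor loses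
    \<open>q\<^sup>2\<close>. Generic \<open>X\<close> and \<open>Y\<close> allow both orders of the
    enumerators.\<close>
  have rem: "X T \<le> (real q)\<^sup>2 * X (T - {i})"
    if m: "\<And>T. T \<subseteq> {..<n} \<Longrightarrow> real q ^ n * X T = real q ^ (2 * card T) * Y ({..<n} - T)"
      and mono: "\<And>S T. S \<subseteq> T \<Longrightarrow> T \<subseteq> {..<n} \<Longrightarrow> Y S \<le> Y T"
      and T: "T \<subseteq> {..<n}" "i \<in> T" for X Y :: "nat set \<Rightarrow> real" and T i
  proof -
    have cT: "card T = Suc (card (T - {i}))"
      using T by (metis card_Suc_Diff1 finite_lessThan finite_subset)
    have "real q ^ n * X T = real q ^ (2 * card T) * Y ({..<n} - T)" using m T by simp
    also have "\<dots> \<le> real q ^ (2 * card T) * Y ({..<n} - (T - {i}))"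
      by (intro mult_left_mono mono) auto
    also have "\<dots> = (real q)\<^sup>2 * (real q ^ (2 * card (T - {i})) * Y ({..<n} - (T - {i})))"
      unfolding cT power2_eq_square by (simp del: card_Diff_insert)
    also have "real q ^ (2 * card (T - {i})) * Y ({..<n} - (T - {i})) = real q ^ n * X (T - {i})"
      using T(1) by (intro m[symmetric]) auto
    finally have "real q ^ n * X T \<le> real q ^ n * ((real q)\<^sup>2 * X (T - {i}))" by (simp add: mult_ac)
    then show ?thesis using rq by simp
  qed
  have C0: "0 \<le> C T" if "T \<subseteq> {..<n}" for T
    unfolding C_def using sub[OF that order_refl] by (intro sum_nonneg c(1)) blast
  have Cle: "C T \<le> A T + B T" if "T \<subseteq> {..<n}" for T
    unfolding A_def B_def C_def sum.distrib[symmetric]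
    using sub[OF that order_refl] by (intro sum_mono c(2)) blast
  have E: "A T + B T > 0" if "T \<subseteq> {..<n}" for T
  proof -
    have "0 < A T" using Amono[of "{}" T] pos that by simp
    moreover have "0 \<le> B T" unfolding B_def by (intro sum_nonneg nonneg)
    ultimately show ?thesis by simp
  qed
  show False
  proof (rule subset_ratio_contradiction[where c = C and e = "\<lambda>T. A T + B T" and \<eta> = \<eta> and k = k
        and n = n and d = "real d" and Q = "(real q)\<^sup>2"])
    show "A T + B T \<le> (real q)\<^sup>2 * (A (T - {i}) + B (T - {i}))"
      if "T \<subseteq> {..<n}" "i \<in> T" for T i
      using rem[OF mac' Bmono that] rem[OF mac Amono that] by (simp add: distrib_left)
    show "(\<Sum>i\<in>T. C (T - {i})) \<le> (real (card T) - real d) * C T" if "T \<subseteq> {..<n}" for T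
      unfolding C_def using that c by (intro sum_labels_remove1 q) auto
    show "1 / 4 \<le> C T / (A T + B T) + C ({..<n} - T) / (A ({..<n} - T) + B ({..<n} - T))"
      if T: "T \<subseteq> {..<n}" "card T = n div 2 + 1" for T
    proof -
      let ?r = "real q ^ (2 * card T)"
      have "?r * (A ({..<n} - T) + B ({..<n} - T)) = real q ^ n * (A T + B T)"
        using mac[OF T(1)] mac'[OF T(1)] by (simp add: distrib_left)
      \<comment> \<open>Both ratios thereby get one common denominator, which reduces the claim to
        \<open>half\<close>.\<close>
      then have "A ({..<n} - T) + B ({..<n} - T) = real q ^ n * (A T + B T) / ?r"
        using rq by (simp add: field_simps)
      then have "C T / (A T + B T) + C ({..<n} - T) / (A ({..<n} - T) + B ({..<n} - T)) =
          (real q ^ n * C T + ?r * C ({..<n} - T)) / (real q ^ n * (A T + B T))"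
        using rq E[OF T(1)] by (simp add: add_divide_distrib)
      also have "\<dots> \<ge> 1 / 4" using half[OF T] rq E[OF T(1)] by (simp add: pos_le_divide_eq)
      finally show ?thesis .
    qed
  qed (use eta k len dist rq E C0 Cle in auto)
qed

section \<open>Base-\<open>q\<close> digits, traces and the identity label\<close>

lemma digit_0: "digit q 0 x = x mod q"
  by (simp add: digit_def)

lemma digit_Suc: "digit q (Suc k) x = digit q k (x div q)"
  by (simp add: digit_def div_mult2_eq)

lemma digits_inject:
  assumes "x < q ^ n" "y < q ^ n" "\<And>k. k < n \<Longrightarrow> digit q k x = digit q k y"
  shows "x = y"
  using assms
proof (induction n arbitrary: x y)
  case (Suc n)
  have "x div q = y div q"
  proof (rule Suc.IH)
    show "x div q < q ^ n" "y div q < q ^ n"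
      using Suc.prems by (simp_all add: less_mult_imp_div_less mult.commute)
    show "digit q k (x div q) = digit q k (y div q)" if "k < n" for k
      using Suc.prems(3)[of "Suc k"] that by (simp add: digit_Suc)
  qed
  moreover have "x mod q = y mod q" using Suc.prems(3)[of 0] by (simp add: digit_0)
  ultimately show ?case by (metis div_mult_mod_eq)
qed simp

text \<open>Writing \<open>x = j + m * q\<close> splits off the lowest digit, and induction factors
  the sum completely. It makes the trace of a product operator the product of the traces of its
  factors.\<close>

lemma sum_prod_digits:
  fixes F :: "nat \<Rightarrow> nat \<Rightarrow> 'a :: comm_semiring_1"
  assumes "q > 0"
  shows "(\<Sum>x<q ^ n. \<Prod>k<n. F k (digit q k x)) = (\<Prod>k<n. \<Sum>j<q. F k j)"
proof (induction n arbitrary: F)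
  case (Suc n)
  have "(\<Sum>x<q ^ Suc n. \<Prod>k<Suc n. F k (digit q k x)) =
      (\<Sum>m<q ^ n. \<Sum>x = m * q..<m * q + q. \<Prod>k<Suc n. F k (digit q k x))"
    by (simp add: sum.nat_group mult.commute)
  also have "\<dots> = (\<Sum>m<q ^ n. \<Sum>j<q. F 0 j * (\<Prod>k<n. F (Suc k) (digit q k m)))"
  proof (rule sum.cong[OF refl])
    fix m
    have "(\<Sum>x = m * q..<m * q + q. \<Prod>k<Suc n. F k (digit q k x)) =
        (\<Sum>j<q. \<Prod>k<Suc n. F k (digit q k (j + m * q)))"
      using sum.shift_bounds_nat_ivl[of "\<lambda>x. \<Prod>k<Suc n. F k (digit q k x)" 0 "m * q" q]
      by (simp add: lessThan_atLeast0 add.commute)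
    also have "\<dots> = (\<Sum>j<q. F 0 j * (\<Prod>k<n. F (Suc k) (digit q k m)))"
      by (intro sum.cong refl) (simp add: prod.lessThan_Suc_shift digit_0 digit_Suc del: prod.lessThan_Suc)
    finally show "(\<Sum>x = m * q..<m * q + q. \<Prod>k<Suc n. F k (digit q k x)) =
        (\<Sum>j<q. F 0 j * (\<Prod>k<n. F (Suc k) (digit q k m)))" .
  qed
  also have "\<dots> = (\<Sum>j<q. F 0 j) * (\<Sum>m<q ^ n. \<Prod>k<n. F (Suc k) (digit q k m))"
    by (simp add: sum_distrib_left sum_distrib_right sum.swap[of _ "{..<q}"])
  also have "\<dots> = (\<Prod>k<Suc n. \<Sum>j<q. F k j)"
    by (simp add: Suc.IH[of "\<lambda>k. F (Suc k)"] prod.lessThan_Suc_shift del: prod.lessThan_Suc)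
  finally show ?case .
qed simp

lemma weyl_op_trace:
  assumes "q > 0" "f \<in> labels q n {..<n}" "supp n f \<noteq> {}"
  shows "(\<Sum>x<q ^ n. weyl_op q n f x x) = 0"
proof -
  obtain k where k: "k < n" "f k \<noteq> (0, 0)" using assms(3) by (auto simp: supp_def)
  then have "f k \<in> {..<q} \<times> {..<q}" using assms(2) by (auto simp: labels_def PiE_iff)
  then have "(\<Sum>j<q. weyl q (f k) j j) = 0"
    using weyl_trace[of "fst (f k)" q "snd (f k)"] k by auto
  then show ?thesis
    unfolding weyl_op_def sum_prod_digits[OF assms(1), of "\<lambda>k j. weyl q (f k) j j" n]
    using k by auto
qed

definition zero_label :: "nat \<Rightarrow> nat \<Rightarrow> nat \<times> nat" where
  "zero_label n = restrict (\<lambda>_. (0, 0)) {..<n}"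

lemma labels_empty: "labels q n {} = {zero_label n}"
proof -
  have "PiE {..<n} (\<lambda>k. {zero_label n k}) = {zero_label n}"
    unfolding zero_label_def by (rule PiE_singleton[OF restrict_extensional])
  moreover have "labels q n {} = PiE {..<n} (\<lambda>k. {zero_label n k})"
    unfolding labels_def zero_label_def by (rule PiE_cong) simp
  ultimately show ?thesis by simp
qed

text \<open>The zero label gives the identity operator: distinct indices differ in some digit, so
  some factor vanishes.\<close>

lemma braket_zero_label:
  assumes "q > 0"
  shows "braket q n \<alpha> \<beta> (zero_label n) = (\<Sum>x<q ^ n. cnj (\<alpha> x) * \<beta> x)"
proof -
  have "weyl_op q n (zero_label n) x y = (if x = y then 1 else 0)"
    if xy: "x < q ^ n" "y < q ^ n" for x y
  proof (cases "x = y")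
    case False
    obtain k where "k < n" "digit q k x \<noteq> digit q k y"
      using digits_inject[OF xy] False by blast
    then have "weyl_op q n (zero_label n) x y = 0"
      using assms unfolding weyl_op_def
      by (intro prod_zero) (auto simp: zero_label_def weyl_0 digit_less)
    then show ?thesis using False by simp
  qed (use assms in \<open>simp add: weyl_op_def zero_label_def weyl_0 digit_less\<close>)
  then have "braket q n \<alpha> \<beta> (zero_label n) =
      (\<Sum>x<q ^ n. \<Sum>y<q ^ n. if x = y then cnj (\<alpha> x) * \<beta> y else 0)"
    unfolding braket_def by (intro sum.cong refl) auto
  then show ?thesis by simp
qed

text \<open>
  For an orthonormal basis \<open>\<psi>\<^sub>s\<close> (\<open>s < \<kappa>\<close>) of a code with projection \<open>P\<close> and the Weyl operator \<open>E\<close>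
  labelled by \<open>f\<close>, these are \<open>|tr (E P)|\<^sup>2\<close> and \<open>tr (E P E\<^sup>* P)\<close>.
\<close>

definition enum_a :: "nat \<Rightarrow> nat \<Rightarrow> nat \<Rightarrow> (nat \<Rightarrow> nat \<Rightarrow> complex) \<Rightarrow> (nat \<Rightarrow> nat \<times> nat) \<Rightarrow> real" where
  "enum_a q n \<kappa> \<psi> f = (cmod (\<Sum>s<\<kappa>. braket q n (\<psi> s) (\<psi> s) f))\<^sup>2"

definition enum_b :: "nat \<Rightarrow> nat \<Rightarrow> nat \<Rightarrow> (nat \<Rightarrow> nat \<Rightarrow> complex) \<Rightarrow> (nat \<Rightarrow> nat \<times> nat) \<Rightarrow> real" where
  "enum_b q n \<kappa> \<psi> f = (\<Sum>s<\<kappa>. \<Sum>t<\<kappa>. (cmod (braket q n (\<psi> s) (\<psi> t) f))\<^sup>2)"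

text \<open>Each summand of \<open>enum_b\<close> is a product of the bracket of \<open>s\<close>,
  \<open>t\<close> with its own conjugate. The exchange of the middle vectors turns it into the
  bracket of \<open>s\<close>, \<open>s\<close> times the conjugate bracket of \<open>t\<close>,
  \<open>t\<close>; summed over \<open>s\<close> and \<open>t\<close> this is the squared modulus in
  \<open>enum_a\<close>.\<close>

lemma enum_macwilliams:
  assumes q: "q > 0" and T: "T \<subseteq> {..<n}"
  shows "real q ^ n * sum (enum_b q n \<kappa> \<psi>) (labels q n T) =
    real q ^ (2 * card T) * sum (enum_a q n \<kappa> \<psi>) (labels q n ({..<n} - T))"
proof -
  let ?br = "\<lambda>s t f. braket q n (\<psi> s) (\<psi> t) f"
  have qpow: "complex_of_real (real q ^ j) = of_nat (q ^ j)" for j by simp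
  have "complex_of_real (real q ^ n * sum (enum_b q n \<kappa> \<psi>) (labels q n T)) =
      of_nat (q ^ n) * (\<Sum>f\<in>labels q n T. \<Sum>s<\<kappa>. \<Sum>t<\<kappa>. ?br s t f * cnj (?br s t f))"
    by (simp only: of_real_mult qpow of_real_sum enum_b_def complex_norm_square)
  also have "(\<Sum>f\<in>labels q n T. \<Sum>s<\<kappa>. \<Sum>t<\<kappa>. ?br s t f * cnj (?br s t f)) =
      (\<Sum>s<\<kappa>. \<Sum>t<\<kappa>. \<Sum>f\<in>labels q n T. ?br s t f * cnj (?br s t f))"
    by (subst sum.swap, intro sum.cong refl)+
  also have "of_nat (q ^ n) * \<dots> = of_nat (q ^ (2 * card T)) * (\<Sum>s<\<kappa>. \<Sum>t<\<kappa>.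
      \<Sum>f\<in>labels q n ({..<n} - T). ?br s s f * cnj (?br t t f))"
    unfolding sum_distrib_left
    by (rule sum.cong[OF refl], rule sum.cong[OF refl])
      (simp only: sum_distrib_left[symmetric] braket_macwilliams[OF q T])
  also have "(\<Sum>s<\<kappa>. \<Sum>t<\<kappa>. \<Sum>f\<in>labels q n ({..<n} - T). ?br s s f * cnj (?br t t f)) =
      (\<Sum>f\<in>labels q n ({..<n} - T). \<Sum>s<\<kappa>. \<Sum>t<\<kappa>. ?br s s f * cnj (?br t t f))"
    by (rule sym, (subst sum.swap, intro sum.cong refl)+)
  also have "\<dots> = (\<Sum>f\<in>labels q n ({..<n} - T). complex_of_real (enum_a q n \<kappa> \<psi> f))"
    by (simp only: enum_a_def complex_norm_square cnj_sum sum_product)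
  also have "of_nat (q ^ (2 * card T)) * \<dots> =
      complex_of_real (real q ^ (2 * card T) * sum (enum_a q n \<kappa> \<psi>) (labels q n ({..<n} - T)))"
    by (simp only: of_real_mult qpow of_real_sum)
  finally show ?thesis unfolding of_real_eq_iff .
qed

text \<open>The previous identity at the complement of \<open>T\<close>, multiplied by
  \<open>q ^ (2 * card T)\<close>, with one factor \<open>q ^ n\<close> cancelled.\<close>

lemma enum_macwilliams':
  assumes q: "q > 0" and T: "T \<subseteq> {..<n}"
  shows "real q ^ n * sum (enum_a q n \<kappa> \<psi>) (labels q n T) =
    real q ^ (2 * card T) * sum (enum_b q n \<kappa> \<psi>) (labels q n ({..<n} - T))"
proof -
  have *: "card ({..<n} - T) = n - card T" "card T \<le> n" "{..<n} - ({..<n} - T) = T"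
    using T card_mono[OF _ T] by (auto simp: card_Diff_subset finite_subset)
  have "real q ^ n * (real q ^ (2 * card T) * sum (enum_b q n \<kappa> \<psi>) (labels q n ({..<n} - T))) =
      real q ^ (2 * card T) * (real q ^ (2 * (n - card T)) * sum (enum_a q n \<kappa> \<psi>) (labels q n T))"
    using enum_macwilliams[OF q, of "{..<n} - T" n \<kappa> \<psi>] * by (simp add: mult_ac)
  also have "\<dots> = real q ^ n * (real q ^ n * sum (enum_a q n \<kappa> \<psi>) (labels q n T))"
    using *(2) by (simp add: mult.assoc[symmetric] power_add[symmetric] mult_2)
  finally show ?thesis using q by simp
qed

section \<open>Contradiction for a unit vector and for an orthonormal pair\<close>

text \<open>For one vector both enumerators coincide, and the conditions say nothing about the
  identity, whose term is 1. Hence \<open>c\<close> omits this term.\<close>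

lemma pure_state_contradiction:
  fixes \<psi> :: "nat \<Rightarrow> complex"
  assumes q: "q \<ge> 2" and eta: "0 < \<eta>" "\<eta> \<le> 1" and k: "(1 - \<eta>) ^ k < 1 / 8"
    and len: "n div 2 + 1 + k \<le> n"
    and dist: "((real q)\<^sup>2 - 1 + \<eta>) * real (n div 2 + 1 + k) \<le> (real q)\<^sup>2 * real d"
    and unit: "(\<Sum>x<q ^ n. cnj (\<psi> x) * \<psi> x) = 1"
    and det: "\<And>f. f \<in> labels q n {..<n} \<Longrightarrow> supp n f \<noteq> {} \<Longrightarrow> card (supp n f) < d \<Longrightarrow>
      braket q n \<psi> \<psi> f = 0"
  shows False
proof -
  define a where "a = enum_a q n 1 (\<lambda>_. \<psi>)"
  have b: "enum_b q n 1 (\<lambda>_. \<psi>) = a"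
    by (simp add: fun_eq_iff a_def enum_a_def enum_b_def)
  define c where "c f = (if supp n f = {} then 0 else a f)" for f
  have q0: "q > 0" using q by simp
  have a0: "0 \<le> a f" for f by (simp add: a_def enum_a_def)
  have one: "sum a (labels q n {}) = 1"
    by (simp add: labels_empty a_def enum_a_def braket_zero_label[OF q0] unit)
  have sub: "labels q n {} \<subseteq> labels q n T" if "T \<subseteq> {..<n}" for T
    using labels_iff[OF q0 empty_subsetI] labels_iff[OF q0 that] by blast
  have c: "sum c (labels q n T) = sum a (labels q n T) - 1" if T: "T \<subseteq> {..<n}" for T
  proof -
    have "sum c (labels q n T) = sum a (labels q n T - labels q n {})"
    proof (rule sum.mono_neutral_cong_right)
      have *: "f \<in> labels q n {} \<longleftrightarrow> supp n f = {}" if "f \<in> labels q n T" for f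
        using labels_iff[OF q0 empty_subsetI] labels_iff[OF q0 T] that by auto
      show "\<forall>f\<in>labels q n T - (labels q n T - labels q n {}). c f = 0"
        using * by (simp add: c_def)
      show "c f = a f" if "f \<in> labels q n T - labels q n {}" for f
        using *[of f] that by (auto simp: c_def)
    qed (auto simp: finite_labels)
    then show ?thesis using sub[OF T] one by (simp add: sum_diff finite_labels)
  qed
  have mac: "real q ^ n * sum a (labels q n T) =
      real q ^ (2 * card T) * sum a (labels q n ({..<n} - T))" if "T \<subseteq> {..<n}" for T
    using enum_macwilliams[OF q0 that, of 1 "\<lambda>_. \<psi>"] unfolding b a_def[symmetric] .
  have ge1: "1 \<le> sum a (labels q n T)" if "T \<subseteq> {..<n}" for T
    using sum_mono2[OF finite_labels sub[OF that], of a] a0 one by simp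
  show False
  proof (rule enumerator_contradiction[where a = a and b = a and c = c and q = q and n = n and d = d
        and \<eta> = \<eta> and k = k])
    show "c f = 0" if "f \<in> labels q n {..<n}" "card (supp n f) < d" for f
      using det[OF that(1) _ that(2)] by (auto simp: c_def a_def enum_a_def)
    show "real q ^ n * (sum a (labels q n T) + sum a (labels q n T)) \<le>
        4 * (real q ^ n * sum c (labels q n T) +
          real q ^ (2 * card T) * sum c (labels q n ({..<n} - T)))"
      if T: "T \<subseteq> {..<n}" "card T = n div 2 + 1" for T
    proof -
      \<comment> \<open>Since \<open>2 * card T\<close> is at least \<open>n + 1\<close>, the
        MacWilliams identity makes the sum over \<open>T\<close> at least \<open>q\<close>, hence at
        least 2, given that the sum over the complement is at least 1. Dropping the identity term
        then costs at most half; this is why the size exceeds \<open>n / 2\<close>.\<close>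
      have "2 * real q ^ n \<le> real q ^ Suc n" using q by simp
      also have "\<dots> \<le> real q ^ (2 * card T)"
        using q by (intro power_increasing) (auto simp: T(2))
      also have "\<dots> \<le> real q ^ (2 * card T) * sum a (labels q n ({..<n} - T))"
        using mult_left_mono[OF ge1[of "{..<n} - T"], of "real q ^ (2 * card T)"] by simp
      also have "\<dots> = real q ^ n * sum a (labels q n T)" using mac[OF T(1)] by simp
      finally have "2 \<le> sum a (labels q n T)" using q by simp
      then have "real q ^ n * (sum a (labels q n T) + sum a (labels q n T)) \<le>
          4 * (real q ^ n * (sum a (labels q n T) - 1))"
        unfolding mult.left_commute[of 4] by (intro mult_left_mono) auto
      moreover have "0 \<le> real q ^ (2 * card T) * sum c (labels q n ({..<n} - T))"
        using c[of "{..<n} - T"] ge1[of "{..<n} - T"] by simp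
      moreover have "x \<le> 4 * (y + z)" if "x \<le> 4 * y" "0 \<le> z" for x y z :: real
        using that by simp
      ultimately show ?thesis unfolding c[OF T(1)] by blast
    qed
  qed (use q0 eta k len dist a0 one mac in \<open>auto simp: c_def\<close>)
qed

text \<open>Two orthonormal code vectors suffice. With two vectors \<open>a / 2 \<le> b\<close>,
  with equality for a detected operator, so \<open>c = b - a / 2\<close> is nonnegative and vanishes
  at low weight.\<close>

lemma code_pair_contradiction:
  fixes \<psi> :: "nat \<Rightarrow> nat \<Rightarrow> complex"
  assumes q: "q > 0" and eta: "0 < \<eta>" "\<eta> \<le> 1" and k: "(1 - \<eta>) ^ k < 1 / 8"
    and len: "n div 2 + 1 + k \<le> n"
    and dist: "((real q)\<^sup>2 - 1 + \<eta>) * real (n div 2 + 1 + k) \<le> (real q)\<^sup>2 * real d"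
    and unit: "\<And>s. s < 2 \<Longrightarrow> (\<Sum>x<q ^ n. cnj (\<psi> s x) * \<psi> s x) = 1"
    and det: "\<And>f. f \<in> labels q n {..<n} \<Longrightarrow> card (supp n f) < d \<Longrightarrow>
      \<exists>c. \<forall>s<2. \<forall>t<2. braket q n (\<psi> s) (\<psi> t) f = (if s = t then c else 0)"
  shows False
proof -
  define a where "a = enum_a q n 2 \<psi>"
  define b where "b = enum_b q n 2 \<psi>"
  define c where "c f = b f - a f / 2" for f
  let ?A = "\<lambda>T. sum a (labels q n T)" and ?B = "\<lambda>T. sum b (labels q n T)"
  have a0: "0 \<le> a f" for f by (simp add: a_def enum_a_def)
  have b0: "0 \<le> b f" for f by (simp add: b_def enum_b_def sum_nonneg)
  \<comment> \<open>The inequality for the squared modulus of a sum of two numbers is applied to the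
    diagonal brackets; the off-diagonal ones only increase \<open>b\<close>.\<close>
  have c0: "0 \<le> c f" for f
  proof -
    have "(cmod (x + y))\<^sup>2 \<le> 2 * (cmod x)\<^sup>2 + 2 * (cmod y)\<^sup>2" for x y
    proof -
      have "(cmod (x + y))\<^sup>2 \<le> (cmod x + cmod y)\<^sup>2"
        by (intro power_mono norm_triangle_ineq) simp
      also have "\<dots> \<le> 2 * (cmod x)\<^sup>2 + 2 * (cmod y)\<^sup>2"
        using zero_le_power2[of "cmod x - cmod y"] by (simp add: power2_eq_square algebra_simps)
      finally show ?thesis .
    qed
    from this[of "braket q n (\<psi> 0) (\<psi> 0) f" "braket q n (\<psi> 1) (\<psi> 1) f"]
    have "a f \<le> 2 * (cmod (braket q n (\<psi> 0) (\<psi> 0) f))\<^sup>2 + 2 * (cmod (braket q n (\<psi> 1) (\<psi> 1) f))\<^sup>2"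
      by (simp add: a_def enum_a_def numeral_2_eq_2)
    moreover have "b f = (cmod (braket q n (\<psi> 0) (\<psi> 0) f))\<^sup>2 + (cmod (braket q n (\<psi> 0) (\<psi> 1) f))\<^sup>2 +
        ((cmod (braket q n (\<psi> 1) (\<psi> 0) f))\<^sup>2 + (cmod (braket q n (\<psi> 1) (\<psi> 1) f))\<^sup>2)"
      by (simp add: b_def enum_b_def numeral_2_eq_2)
    ultimately show ?thesis
      using zero_le_power2[of "cmod (braket q n (\<psi> 0) (\<psi> 1) f)"]
        zero_le_power2[of "cmod (braket q n (\<psi> 1) (\<psi> 0) f)"]
      unfolding c_def by linarith
  qed
  have csum: "sum c (labels q n T) = ?B T - ?A T / 2" for T
    by (simp add: c_def sum_subtractf sum_divide_distrib)
  have mac: "real q ^ n * ?B T = real q ^ (2 * card T) * ?A ({..<n} - T)"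
    and mac': "real q ^ n * ?A T = real q ^ (2 * card T) * ?B ({..<n} - T)" if "T \<subseteq> {..<n}" for T
    unfolding a_def b_def using enum_macwilliams[OF q that] enum_macwilliams'[OF q that] by auto
  show False
  proof (rule enumerator_contradiction[where a = a and b = b and c = c and q = q and n = n and d = d
        and \<eta> = \<eta> and k = k])
    \<comment> \<open>The brackets form \<open>z\<close> times the 2 by 2 identity matrix, so
      \<open>a f\<close> is four times and \<open>b f\<close> twice the squared modulus of
      \<open>z\<close>.\<close>
    show "c f = 0" if f: "f \<in> labels q n {..<n}" "card (supp n f) < d" for f
    proof -
      obtain z where "\<And>s t. s < 2 \<Longrightarrow> t < 2 \<Longrightarrow>
          braket q n (\<psi> s) (\<psi> t) f = (if s = t then z else 0)"
        using det[OF f] by blast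
      then have "enum_a q n 2 \<psi> f = (cmod (\<Sum>s<2::nat. z))\<^sup>2"
        "enum_b q n 2 \<psi> f = (\<Sum>s<2::nat. \<Sum>t<2::nat. (cmod (if s = t then z else 0))\<^sup>2)"
        unfolding enum_a_def enum_b_def by simp_all
      then show ?thesis
        by (simp add: c_def a_def b_def numeral_2_eq_2 norm_mult power_mult_distrib
            flip: mult_2)
    qed
    have "braket q n (\<psi> s) (\<psi> s) (zero_label n) = 1" if "s < 2" for s
      by (simp add: braket_zero_label[OF q] unit that)
    then show "0 < ?A {}" by (simp add: labels_empty a_def enum_a_def)
    show "real q ^ n * (?A T + ?B T) \<le>
        4 * (real q ^ n * sum c (labels q n T) +
          real q ^ (2 * card T) * sum c (labels q n ({..<n} - T)))"
      if T: "T \<subseteq> {..<n}" "card T = n div 2 + 1" for T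
    proof -
      \<comment> \<open>The MacWilliams identities interchange the enumerators at the complement, so
        the total is \<open>q ^ n\<close> times
        \<open>(B - A / 2) + (A - B / 2) = (A + B) / 2\<close>.\<close>
      have "real q ^ n * sum c (labels q n T) +
          real q ^ (2 * card T) * sum c (labels q n ({..<n} - T)) =
          real q ^ n * ?B T - real q ^ n * ?A T / 2 +
          (real q ^ (2 * card T) * ?B ({..<n} - T) - real q ^ (2 * card T) * ?A ({..<n} - T) / 2)"
        by (simp add: csum right_diff_distrib)
      also have "\<dots> = real q ^ n * (?A T + ?B T) / 2"
        unfolding mac[OF T(1), symmetric] mac'[OF T(1), symmetric] by (simp add: field_simps)
      finally have "real q ^ n * sum c (labels q n T) +
          real q ^ (2 * card T) * sum c (labels q n ({..<n} - T)) =
          real q ^ n * (?A T + ?B T) / 2" .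
      moreover have "0 \<le> real q ^ n * (?A T + ?B T)"
        using a0 b0 by (intro mult_nonneg_nonneg add_nonneg_nonneg sum_nonneg) auto
      moreover have "x \<le> 4 * y" if "y = x / 2" "0 \<le> x" for x y :: real
        using that by simp
      ultimately show ?thesis by blast
    qed
    show "c f \<le> a f + b f" for f using a0[of f] by (simp add: c_def)
  qed (use q eta k len dist a0 b0 c0 mac mac' in auto)
qed

subsection \<open>Quantum codes\<close>

lemma cscalar_prod_sum:
  fixes u v :: "complex vec"
  assumes "v \<in> carrier_vec N" "u \<in> carrier_vec N"
  shows "v \<bullet>c u = (\<Sum>x<N. v $ x * cnj (u $ x))"
  using assms by (auto simp: scalar_prod_def lessThan_atLeast0 intro!: sum.cong)

definition weyl_mat :: "nat \<Rightarrow> nat \<Rightarrow> (nat \<Rightarrow> nat \<times> nat) \<Rightarrow> complex mat" where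
  "weyl_mat q n f = tensor_op q n (\<lambda>k. mat q q (\<lambda>(i, j). weyl q (f k) i j))"

lemma weyl_mat_carrier: "weyl_mat q n f \<in> carrier_mat (q ^ n) (q ^ n)"
  by (simp add: weyl_mat_def tensor_op_def)

lemma weyl_mat_index:
  assumes "q > 0" "x < q ^ n" "y < q ^ n"
  shows "weyl_mat q n f $$ (x, y) = weyl_op q n f x y"
  using assms by (simp add: weyl_mat_def tensor_op_def weyl_op_def digit_less)

text \<open>A nontrivial Weyl operator has trace 0, so it could only be the scalar 0; but its entry
  in row \<open>fst l\<close>, column 0 is 1. Consequently the weight of a product of Weyl operators
  is the size of its support.\<close>

lemma weyl_scalar_iff:
  assumes "q > 0" "l \<in> {..<q} \<times> {..<q}"
  shows "(\<exists>c. mat q q (\<lambda>(i, j). weyl q l i j) = c \<cdot>\<^sub>m 1\<^sub>m q) \<longleftrightarrow> l = (0, 0)"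
proof
  assume "\<exists>c. mat q q (\<lambda>(i, j). weyl q l i j) = c \<cdot>\<^sub>m 1\<^sub>m q"
  then obtain c where c: "mat q q (\<lambda>(i, j). weyl q l i j) = c \<cdot>\<^sub>m 1\<^sub>m q" by blast
  have ent: "weyl q l i j = (if i = j then c else 0)" if "i < q" "j < q" for i j
    using arg_cong[OF c, of "\<lambda>M. M $$ (i, j)"] that by simp
  show "l = (0, 0)"
  proof (rule ccontr)
    assume "l \<noteq> (0, 0)"
    then have "(\<Sum>i<q. weyl q l i i) = 0"
      using weyl_trace[of "fst l" q "snd l"] assms(2) by auto
    then have "c = 0" using ent assms(1) by simp
    then have "weyl q l (fst l) 0 = 0" using ent[of "fst l" 0] assms by (auto split: if_splits)
    then show False using assms by (auto simp: weyl_def)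
  qed
next
  assume "l = (0, 0)"
  then have "mat q q (\<lambda>(i, j). weyl q l i j) = 1 \<cdot>\<^sub>m 1\<^sub>m q"
    by (intro eq_matI) (auto simp: weyl_0)
  then show "\<exists>c. mat q q (\<lambda>(i, j). weyl q l i j) = c \<cdot>\<^sub>m 1\<^sub>m q" ..
qed

lemma weyl_mat_weight:
  assumes "q > 0" "f \<in> labels q n {..<n}"
  shows "weyl_mat q n f \<in> ops_of_weight q n (card (supp n f))"
proof -
  have "f k \<in> {..<q} \<times> {..<q}" if "k < n" for k
    using assms(2) that by (auto simp: labels_def PiE_iff)
  then have "{k. k < n \<and> \<not> (\<exists>c. mat q q (\<lambda>(i, j). weyl q (f k) i j) = c \<cdot>\<^sub>m 1\<^sub>m q)} = supp n f"
    unfolding supp_def using weyl_scalar_iff[OF assms(1)] by blast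
  then show ?thesis unfolding ops_of_weight_def weyl_mat_def
    by (intro CollectI exI[of _ "\<lambda>k. mat q q (\<lambda>(i, j). weyl q (f k) i j)"]) auto
qed

lemma braket_eq_cscalar_prod:
  assumes "q > 0" "u \<in> carrier_vec (q ^ n)" "v \<in> carrier_vec (q ^ n)"
  shows "braket q n (\<lambda>x. u $ x) (\<lambda>x. v $ x) f = (weyl_mat q n f *\<^sub>v v) \<bullet>c u"
proof -
  have "(weyl_mat q n f *\<^sub>v v) $ x = (\<Sum>y<q ^ n. weyl_op q n f x y * v $ y)" if "x < q ^ n" for x
    using that assms weyl_mat_carrier[of q n f]
    by (auto simp: scalar_prod_def weyl_mat_index lessThan_atLeast0 intro!: sum.cong)
  moreover have "(weyl_mat q n f *\<^sub>v v) \<bullet>c u = (\<Sum>x<q ^ n. (weyl_mat q n f *\<^sub>v v) $ x * cnj (u $ x))"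
    using assms(2,3) weyl_mat_carrier[of q n f]
    by (intro cscalar_prod_sum mult_mat_vec_carrier) auto
  ultimately show ?thesis
    by (simp add: braket_def sum_distrib_left sum_distrib_right mult_ac)
qed

lemma mat_trace_weyl_mat:
  assumes "q > 0" "f \<in> labels q n {..<n}" "supp n f \<noteq> {}"
  shows "mat_trace (weyl_mat q n f) = 0"
proof -
  have "mat_trace (weyl_mat q n f) = (\<Sum>x<q ^ n. weyl_op q n f x x)"
    using weyl_mat_carrier[of q n f] assms(1)
    by (auto simp: mat_trace_def weyl_mat_index intro!: sum.cong)
  then show ?thesis using weyl_op_trace[OF assms] by simp
qed

lemma cscalar_prod_adjoint:
  fixes A :: "complex mat"
  assumes A: "A \<in> carrier_mat N N" and v: "v \<in> carrier_vec N" and w: "w \<in> carrier_vec N"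
  shows "(A *\<^sub>v v) \<bullet>c w = v \<bullet>c (mat_adjoint A *\<^sub>v w)"
proof -
  have mv: "(B *\<^sub>v x) $ i = (\<Sum>j<N. B $$ (i, j) * x $ j)"
    if "B \<in> carrier_mat N N" "x \<in> carrier_vec N" "i < N" for B :: "complex mat" and x i
    using that by (auto simp: scalar_prod_def lessThan_atLeast0 intro!: sum.cong)
  have Ad: "mat_adjoint A \<in> carrier_mat N N" by (rule adjoint_dim[OF A])
  have "(A *\<^sub>v v) \<bullet>c w = (\<Sum>i<N. \<Sum>j<N. A $$ (i, j) * v $ j * cnj (w $ i))"
    using A v w by (simp add: cscalar_prod_sum[of _ N] mv sum_distrib_right del: index_mult_mat_vec)
  also have "\<dots> = (\<Sum>j<N. \<Sum>i<N. A $$ (i, j) * v $ j * cnj (w $ i))"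
    by (rule sum.swap)
  also have "\<dots> = (\<Sum>j<N. v $ j * cnj (\<Sum>i<N. mat_adjoint A $$ (j, i) * w $ i))"
    by (simp add: adjoint_index[OF A] sum_distrib_left mult_ac)
  also have "\<dots> = v \<bullet>c (mat_adjoint A *\<^sub>v w)"
    using Ad v w by (simp add: cscalar_prod_sum[of _ N] mv del: index_mult_mat_vec)
  finally show ?thesis .
qed

section \<open>Orthonormal vectors in a code\<close>

lemma subspace_carrier_vec:
  assumes "VectorSpace.subspace class_ring Q (module_vec TYPE(complex) N)" "v \<in> Q"
  shows "v \<in> carrier_vec N"
  using submodule.subset[of class_ring Q "module_vec TYPE(complex) N"] assms
  by (auto simp: VectorSpace.subspace_def module_vec_simps)

lemma subspace_smult:
  assumes "VectorSpace.subspace class_ring Q (module_vec TYPE(complex) N)" "v \<in> Q"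
  shows "c \<cdot>\<^sub>v v \<in> Q"
  using submodule.smult_closed[of class_ring Q "module_vec TYPE(complex) N" c v] assms
  by (auto simp: VectorSpace.subspace_def module_vec_simps class_ring_simps)

lemma subspace_add:
  assumes "VectorSpace.subspace class_ring Q (module_vec TYPE(complex) N)" "v \<in> Q" "w \<in> Q"
  shows "v + w \<in> Q"
  using submodule.m_closed[of class_ring Q "module_vec TYPE(complex) N" v w] assms
  by (auto simp: VectorSpace.subspace_def module_vec_simps)

lemma subspace_zero:
  assumes "VectorSpace.subspace class_ring Q (module_vec TYPE(complex) N)"
  shows "0\<^sub>v N \<in> Q"
  using submodule.zero_closed[of class_ring Q "module_vec TYPE(complex) N"] assms
  by (auto simp: VectorSpace.subspace_def module_vec_simps)

text \<open>Used contrapositively: positive dimension yields a nonzero vector, and dimension at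
  least 2 yields a vector outside any given line of the code.\<close>

lemma dim_subspace_le_1:
  fixes Q :: "complex vec set" and N :: nat
  defines "W \<equiv> (module_vec TYPE(complex) N)\<lparr>carrier := Q\<rparr>"
  assumes Q: "VectorSpace.subspace class_ring Q (module_vec TYPE(complex) N)"
    and v: "v \<in> Q" and gen: "\<And>w. w \<in> Q \<Longrightarrow> \<exists>c. w = c \<cdot>\<^sub>v v"
  shows "vectorspace.dim class_ring W \<le> 1"
    and "v = 0\<^sub>v N \<Longrightarrow> vectorspace.dim class_ring W = 0"
proof -
  interpret V: cof_vec_space N "TYPE(complex)" .
  interpret W: vectorspace class_ring W
    unfolding W_def using Q by (rule V.subspace_is_vs)
  have vW: "{v} \<subseteq> carrier W" using v by (simp add: W_def)
  have "W.span {v} = carrier W"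
  proof
    show "W.span {v} \<subseteq> carrier W" using vW by (rule W.span_is_subset2)
    show "carrier W \<subseteq> W.span {v}"
    proof
      fix w assume "w \<in> carrier W"
      then obtain c where "w = c \<cdot>\<^sub>v v" using gen by (auto simp: W_def)
      moreover have "c \<odot>\<^bsub>W\<^esub> v \<in> W.span {v}"
        using W.in_own_span[OF vW] W.span_is_submodule[OF vW]
        by (intro submodule.smult_closed) (auto simp: class_ring_simps)
      ultimately show "w \<in> W.span {v}" by (simp add: W_def module_vec_simps)
    qed
  qed
  then show "W.dim \<le> 1" using vW by (intro W.dim_le1I) auto
  assume "v = 0\<^sub>v N"
  then have "v = \<zero>\<^bsub>W\<^esub>" by (simp add: W_def module_vec_simps)
  then show "W.dim = 0" using \<open>W.span {v} = carrier W\<close> by (intro W.dim0I) simp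
qed

lemma subspace_normalize:
  assumes Q: "VectorSpace.subspace class_ring Q (module_vec TYPE(complex) N)"
    and w: "w \<in> Q" "w \<noteq> 0\<^sub>v N"
  shows "\<exists>c. c \<cdot>\<^sub>v w \<in> Q \<and> (c \<cdot>\<^sub>v w) \<bullet>c (c \<cdot>\<^sub>v w) = 1"
proof -
  have wC: "w \<in> carrier_vec N" using subspace_carrier_vec[OF Q w(1)] .
  define r where "r = (\<Sum>x<N. (cmod (w $ x))\<^sup>2)"
  have ww: "w \<bullet>c w = of_real r"
    unfolding r_def by (simp add: cscalar_prod_sum[OF wC wC] complex_norm_square del: of_real_power)
  have "r \<ge> 0" unfolding r_def by (rule sum_nonneg) simp
  moreover have "r \<noteq> 0" using ww w(2) conjugate_square_eq_0_vec[OF wC] by auto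
  ultimately have r: "r > 0" by simp
  let ?c = "complex_of_real (1 / sqrt r)"
  have "(?c \<cdot>\<^sub>v w) \<bullet>c (?c \<cdot>\<^sub>v w) = ?c * cnj ?c * (w \<bullet>c w)"
    using wC by (simp add: cscalar_prod_sum[of _ N] sum_distrib_left mult_ac)
  also have "\<dots> = of_real (1 / sqrt r * (1 / sqrt r) * r)" unfolding ww
    by (simp only: of_real_mult complex_cnj_complex_of_real)
  also have "1 / sqrt r * (1 / sqrt r) * r = 1" using r by (simp add: field_simps)
  finally have "(?c \<cdot>\<^sub>v w) \<bullet>c (?c \<cdot>\<^sub>v w) = 1" by (simp only: of_real_1)
  then show ?thesis using subspace_smult[OF Q w(1)] by blast
qed

lemma quantum_code_unit_vector:
  assumes "quantum_code q n K Q"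
  obtains \<psi> where "\<psi> \<in> Q" "\<psi> \<bullet>c \<psi> = 1"
proof -
  have Q: "VectorSpace.subspace class_ring Q (module_vec TYPE(complex) (q ^ n))"
    and K: "code_dim q n Q \<ge> 1" using assms by (auto simp: quantum_code_def)
  have "\<exists>w\<in>Q. w \<noteq> 0\<^sub>v (q ^ n)"
  proof (rule ccontr)
    assume "\<not> (\<exists>w\<in>Q. w \<noteq> 0\<^sub>v (q ^ n))"
    moreover have "(0 :: complex) \<cdot>\<^sub>v 0\<^sub>v (q ^ n) = 0\<^sub>v (q ^ n)" by auto
    ultimately have "\<And>w. w \<in> Q \<Longrightarrow> \<exists>c. w = c \<cdot>\<^sub>v 0\<^sub>v (q ^ n)" by metis
    then show False
      using dim_subspace_le_1(2)[OF Q subspace_zero[OF Q]] K by (simp add: code_dim_def)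
  qed
  then show ?thesis using subspace_normalize[OF Q] that by blast
qed

lemma quantum_code_orthonormal_pair:
  assumes "quantum_code q n K Q" "code_dim q n Q \<ge> 2"
  obtains u v where "u \<in> Q" "v \<in> Q" "u \<bullet>c u = 1" "v \<bullet>c v = 1" "u \<bullet>c v = 0" "v \<bullet>c u = 0"
proof -
  let ?N = "q ^ n"
  have Q: "VectorSpace.subspace class_ring Q (module_vec TYPE(complex) ?N)"
    using assms by (auto simp: quantum_code_def)
  note C = subspace_carrier_vec[OF Q]
  obtain u where u: "u \<in> Q" "u \<bullet>c u = 1" using quantum_code_unit_vector[OF assms(1)] .
  have "\<exists>w\<in>Q. \<forall>c. w \<noteq> c \<cdot>\<^sub>v u"
    using dim_subspace_le_1(1)[OF Q u(1)] assms(2) by (force simp: code_dim_def)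
  then obtain w where w: "w \<in> Q" "\<And>c. w \<noteq> c \<cdot>\<^sub>v u" by auto
  \<comment> \<open>One Gram-Schmidt step: subtracting the component along \<open>u\<close> leaves a
    nonzero vector because \<open>w\<close> is not a multiple of \<open>u\<close>.\<close>
  define a where "a = w \<bullet>c u"
  define z where "z = w + (- a) \<cdot>\<^sub>v u"
  have z: "z \<in> Q" unfolding z_def using Q u w by (intro subspace_add subspace_smult)
  have "z \<noteq> 0\<^sub>v ?N"
  proof
    assume z0: "z = 0\<^sub>v ?N"
    have "w = a \<cdot>\<^sub>v u"
    proof (rule eq_vecI)
      fix x assume "x < dim_vec (a \<cdot>\<^sub>v u)"
      then have "x < ?N" using C[OF u(1)] by simp
      then show "w $ x = (a \<cdot>\<^sub>v u) $ x"
        using arg_cong[OF z0, of "\<lambda>v. v $ x"] C[OF u(1)] C[OF w(1)] by (simp add: z_def)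
    qed (use C[OF u(1)] C[OF w(1)] in simp)
    then show False using w(2) by blast
  qed
  then obtain c where c: "c \<cdot>\<^sub>v z \<in> Q" "(c \<cdot>\<^sub>v z) \<bullet>c (c \<cdot>\<^sub>v z) = 1"
    using subspace_normalize[OF Q z] by blast
  have "z \<bullet>c u = a + (- a) * (u \<bullet>c u)"
    unfolding z_def using C[OF u(1)] C[OF w(1)]
    by (subst add_scalar_prod_distrib[of _ ?N]) (auto simp: a_def)
  then have "z \<bullet>c u = 0" using u by simp
  then have cz: "(c \<cdot>\<^sub>v z) \<bullet>c u = 0" using C[OF z] C[OF u(1)] by simp
  moreover have "u \<bullet>c (c \<cdot>\<^sub>v z) = cnj ((c \<cdot>\<^sub>v z) \<bullet>c u)"
    using C[OF c(1)] C[OF u(1)] by (simp add: cscalar_prod_sum[of _ ?N] mult_ac)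
  ultimately show ?thesis using that[OF u(1) c(1) u(2) c(2)] by simp
qed

section \<open>From the distance conditions to the asymptotic bound\<close>

lemma orth_proj_fixes:
  assumes P: "is_orth_proj N Q P" and v: "v \<in> Q"
  shows "P *\<^sub>v v = v"
proof -
  have P': "P \<in> carrier_mat N N" "P * P = P" using P by (auto simp: is_orth_proj_def)
  obtain w where w: "w \<in> carrier_vec N" "v = P *\<^sub>v w" using P v by (auto simp: is_orth_proj_def)
  have "P *\<^sub>v v = (P * P) *\<^sub>v w"
    unfolding w(2) using assoc_mult_mat_vec[OF P'(1) P'(1) w(1)] by simp
  then show ?thesis unfolding P'(2) w(2) .
qed

text \<open>Code vectors are fixed by the self-adjoint \<open>P\<close>, so their matrix elements
  for \<open>E\<close> equal those for \<open>P * E * P\<close>, a multiple of \<open>P\<close>. The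
  constant \<open>c\<close> is the same for all pairs of code vectors.\<close>

lemma detects_below_braket:
  assumes q: "q > 0" and Q: "VectorSpace.subspace class_ring Q (module_vec TYPE(complex) (q ^ n))"
    and det: "detects_below q n Q d"
    and f: "f \<in> labels q n {..<n}" "card (supp n f) < d"
  shows "\<exists>c. \<forall>u\<in>Q. \<forall>v\<in>Q. (weyl_mat q n f *\<^sub>v v) \<bullet>c u = c * (v \<bullet>c u)"
proof -
  let ?N = "q ^ n"
  define P where "P = orth_proj ?N Q"
  let ?E = "weyl_mat q n f"
  have P: "is_orth_proj ?N Q P" unfolding P_def by (rule is_orth_proj_orth_proj[OF Q])
  then have PC: "P \<in> carrier_mat ?N ?N" and adj: "mat_adjoint P = P"
    by (auto simp: is_orth_proj_def)
  note EC = weyl_mat_carrier[of q n f]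
  interpret M: vectorspace class_ring "module_mat TYPE(complex) ?N ?N"
    by (rule matrix_vs)
  have "(\<Union>w<d. ops_of_weight q n w) \<subseteq> carrier (module_mat TYPE(complex) ?N ?N)"
    by (auto simp: ops_of_weight_def tensor_op_def module_mat_simps)
  then have "?E \<in> M.span (\<Union>w<d. ops_of_weight q n w)"
    using M.in_own_span weyl_mat_weight[OF q f(1)] f(2) by blast
  then obtain c where c: "P * ?E * P = c \<cdot>\<^sub>m P"
    using det unfolding detects_below_def P_def Let_def by blast
  have "(?E *\<^sub>v v) \<bullet>c u = c * (v \<bullet>c u)" if u: "u \<in> Q" and v: "v \<in> Q" for u v
  proof -
    note uC = subspace_carrier_vec[OF Q u] and vC = subspace_carrier_vec[OF Q v]
    note Pu = orth_proj_fixes[OF P u] and Pv = orth_proj_fixes[OF P v]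
    have "(?E *\<^sub>v v) \<bullet>c u = (?E *\<^sub>v v) \<bullet>c (mat_adjoint P *\<^sub>v u)" by (simp add: adj Pu)
    also have "\<dots> = (P *\<^sub>v (?E *\<^sub>v v)) \<bullet>c u"
      using EC vC uC PC by (intro cscalar_prod_adjoint[symmetric]) auto
    also have "P *\<^sub>v (?E *\<^sub>v v) = P *\<^sub>v (?E *\<^sub>v (P *\<^sub>v v))" by (simp add: Pv)
    also have "\<dots> = (P * ?E * P) *\<^sub>v v"
      using PC EC vC by (simp add: assoc_mult_mat_vec[of _ ?N ?N _ ?N])
    also have "\<dots> = c \<cdot>\<^sub>v (P *\<^sub>v v)"
      unfolding c using PC vC
      by (intro eq_vecI) (auto simp: scalar_prod_def sum_distrib_left mult.assoc)
    also have "\<dots> = c \<cdot>\<^sub>v v" unfolding Pv ..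
    also have "(c \<cdot>\<^sub>v v) \<bullet>c u = c * (v \<bullet>c u)" using vC uC by simp
    finally show ?thesis .
  qed
  then show ?thesis by blast
qed

lemma distance_contradiction:
  assumes q: "q \<ge> 2" and eta: "0 < \<eta>" "\<eta> \<le> 1" and k: "(1 - \<eta>) ^ k < 1 / 8"
    and len: "n div 2 + 1 + k \<le> n"
    and dist: "((real q)\<^sup>2 - 1 + \<eta>) * real (n div 2 + 1 + k) \<le> (real q)\<^sup>2 * real d"
    and code: "quantum_code q n K Q"
    and det: "if code_dim q n Q \<ge> 2 then detects_below q n Q d else uniform_below q n Q d"
  shows False
proof (cases "code_dim q n Q \<ge> 2")
  case True
  have q0: "q > 0" using q by simp
  have Q: "VectorSpace.subspace class_ring Q (module_vec TYPE(complex) (q ^ n))"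
    using code by (auto simp: quantum_code_def)
  note C = subspace_carrier_vec[OF Q]
  obtain u v where uv: "u \<in> Q" "v \<in> Q" "u \<bullet>c u = 1" "v \<bullet>c v = 1" "u \<bullet>c v = 0" "v \<bullet>c u = 0"
    using quantum_code_orthonormal_pair[OF code True] .
  define \<psi> where "\<psi> s = (if s = 0 then u else v)" for s :: nat
  have \<psi>: "\<psi> s \<in> Q" for s using uv by (simp add: \<psi>_def)
  have ortho: "\<psi> t \<bullet>c \<psi> s = (if s = t then 1 else 0)" if "s < 2" "t < 2" for s t
    using that uv by (auto simp: \<psi>_def less_2_cases_iff)
  show False
  proof (rule code_pair_contradiction[OF q0 eta k len dist, where \<psi> = "\<lambda>s x. \<psi> s $ x"])
    show "(\<Sum>x<q ^ n. cnj (\<psi> s $ x) * \<psi> s $ x) = 1" if "s < 2" for s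
      using ortho[OF that that] cscalar_prod_sum[OF C[OF \<psi>] C[OF \<psi>], of s s]
      by (simp add: mult.commute)
    show "\<exists>c. \<forall>s<2. \<forall>t<2. braket q n (\<lambda>x. \<psi> s $ x) (\<lambda>x. \<psi> t $ x) f = (if s = t then c else 0)"
      if f: "f \<in> labels q n {..<n}" "card (supp n f) < d" for f
    proof -
      have "detects_below q n Q d" using det True by simp
      then obtain c where "\<forall>u\<in>Q. \<forall>v\<in>Q. (weyl_mat q n f *\<^sub>v v) \<bullet>c u = c * (v \<bullet>c u)"
        using detects_below_braket[OF q0 Q _ f] by blast
      then show ?thesis
        using \<psi> ortho by (intro exI[of _ c]) (simp add: braket_eq_cscalar_prod[OF q0 C[OF \<psi>] C[OF \<psi>]])
    qed
  qed
next
  case False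
  have q0: "q > 0" using q by simp
  have Q: "VectorSpace.subspace class_ring Q (module_vec TYPE(complex) (q ^ n))"
    using code by (auto simp: quantum_code_def)
  obtain \<psi> where \<psi>: "\<psi> \<in> Q" "\<psi> \<bullet>c \<psi> = 1" using quantum_code_unit_vector[OF code] .
  note C = subspace_carrier_vec[OF Q \<psi>(1)]
  have uni: "uniform_below q n Q d" using det False by simp
  show False
  proof (rule pure_state_contradiction[OF q eta k len dist, where \<psi> = "\<lambda>x. \<psi> $ x"])
    show "(\<Sum>x<q ^ n. cnj (\<psi> $ x) * \<psi> $ x) = 1"
      using \<psi>(2) cscalar_prod_sum[OF C C] by (simp add: mult.commute)
    show "braket q n (\<lambda>x. \<psi> $ x) (\<lambda>x. \<psi> $ x) f = 0"
      if f: "f \<in> labels q n {..<n}" "supp n f \<noteq> {}" "card (supp n f) < d" for f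
    proof -
      have "finite (supp n f)" by (simp add: supp_def)
      then have "1 \<le> card (supp n f)" using f(2) by (simp add: Suc_le_eq card_gt_0_iff)
      then have "(weyl_mat q n f *\<^sub>v \<psi>) \<bullet>c \<psi> = mat_trace (weyl_mat q n f) / of_nat (q ^ n)"
        using uni \<psi> f(3) weyl_mat_weight[OF q0 f(1)] unfolding uniform_below_def by blast
      then show ?thesis
        by (simp add: braket_eq_cscalar_prod[OF q0 C C] mat_trace_weyl_mat[OF q0 f(1,2)])
    qed
  qed
qed

lemma distance_bound:
  assumes q: "q \<ge> 2" and eps: "\<epsilon> > 0"
  obtains N where "\<And>n K Q. n \<ge> N \<Longrightarrow> quantum_code q n K Q \<Longrightarrow>
    real (min_distance q n Q) \<le> (1 / 2 * (1 - 1 / (real q)\<^sup>2) + \<epsilon>) * real n"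
proof -
  \<comment> \<open>The parameters are chosen in the order \<eta>, \<open>k\<close>,
    \<open>N\<close>; \<open>N\<close> ensures that \<open>1 + k\<close> is at most
    \<open>\<eta> * n / 2\<close> for \<open>n \<ge> N\<close>.\<close>
  define \<eta> where "\<eta> = min 1 \<epsilon>"
  have eta: "0 < \<eta>" "\<eta> \<le> 1" "\<eta> \<le> \<epsilon>" using eps by (auto simp: \<eta>_def)
  obtain k where k: "(1 - \<eta>) ^ k < 1 / 8"
    using real_arch_pow_inv[of "1 / 8" "1 - \<eta>"] eta by auto
  obtain N where N: "2 * (1 + real k) / \<eta> \<le> real N" using real_arch_simple by blast
  define S where "S = (real q)\<^sup>2"
  have S: "S \<ge> 1" unfolding S_def using q by simp
  define \<beta> where "\<beta> = 1 / 2 * (1 - 1 / S) + \<epsilon>"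
  have \<beta>: "S * (\<beta> * x) = (S - 1) * x / 2 + S * \<epsilon> * x" for x
    using S by (simp add: \<beta>_def field_simps)
  \<comment> \<open>Proved for every \<open>d\<close> that satisfies the distance condition, because
    it must also bound the set whose \<open>GREATEST\<close> element is taken.\<close>
  have main: "real d \<le> \<beta> * real n"
    if n: "n \<ge> N" and code: "quantum_code q n K Q"
      and det: "if code_dim q n Q \<ge> 2 then detects_below q n Q d else uniform_below q n Q d"
    for n K Q d
  proof (rule ccontr)
    assume d: "\<not> real d \<le> \<beta> * real n"
    have n1: "2 * (1 + real k) \<le> \<eta> * real n"
      using N n eta by (simp add: divide_le_eq) (smt (verit) mult_left_mono mult.commute of_nat_mono)
    also have "\<dots> \<le> real n" using eta by (simp add: mult_left_le_one_le)
    finally have "real (2 * (1 + k)) \<le> real n" by simp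
    then have n2: "2 * (1 + k) \<le> n" by (simp only: of_nat_le_iff)
    have "(S - 1 + \<eta>) * real (n div 2 + 1 + k) \<le> (S - 1 + \<eta>) * (real n / 2 + (1 + real k))"
      using S eta by (intro mult_left_mono) auto
    also have "\<dots> = (S - 1) * real n / 2 + \<eta> * real n / 2 + (S - 1 + \<eta>) * (1 + real k)"
      by (simp add: field_simps)
    \<comment> \<open>Both error terms are at most \<open>S * (\<eta> * n / 2)\<close>, and together
      they fit into the slack \<open>S * \<epsilon> * n\<close>.\<close>
    also have "\<dots> \<le> (S - 1) * real n / 2 + S * \<epsilon> * real n"
    proof -
      have "(S - 1 + \<eta>) * (1 + real k) \<le> S * (\<eta> * real n / 2)"
        using S eta n1 by (intro mult_mono) auto
      moreover have "\<eta> * real n / 2 \<le> S * (\<eta> * real n / 2)"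
        using S eta mult_right_mono[of 1 S "\<eta> * real n / 2"] by simp
      moreover have "S * (\<eta> * real n / 2) + S * (\<eta> * real n / 2) \<le> S * \<epsilon> * real n"
        using S eta by (simp add: mult_left_mono mult_right_mono)
      moreover have "p + y + x \<le> p + z" if "x \<le> w" "y \<le> w" "w + w \<le> z" for p w x y z :: real
        using that by simp
      ultimately show ?thesis by blast
    qed
    also have "\<dots> = S * (\<beta> * real n)" using \<beta> by simp
    also have "\<dots> \<le> S * real d" using d S by (intro mult_left_mono) auto
    finally have "(S - 1 + \<eta>) * real (n div 2 + 1 + k) \<le> S * real d" .
    moreover have "n div 2 + 1 + k \<le> n" using n2 by presburger
    ultimately show False
      using distance_contradiction[OF q eta(1,2) k _ _ code det] unfolding S_def by blast
  qed
  have "real (min_distance q n Q) \<le> \<beta> * real n" if n: "n \<ge> N" and code: "quantum_code q n K Q" for n K Q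
  proof (cases "code_dim q n Q \<ge> 2")
    case True
    have Q: "VectorSpace.subspace class_ring Q (module_vec TYPE(complex) (q ^ n))"
      using code by (auto simp: quantum_code_def)
    have bd: "real d \<le> \<beta> * real n" if "detects_below q n Q d" for d
      using main[OF n code] True that by auto
    interpret M: vectorspace class_ring "module_mat TYPE(complex) (q ^ n) (q ^ n)"
      by (rule matrix_vs)
    have "orth_proj (q ^ n) Q \<in> carrier_mat (q ^ n) (q ^ n)"
      using is_orth_proj_orth_proj[OF Q] by (simp add: is_orth_proj_def)
    \<comment> \<open>For \<open>d = 0\<close> no operators generate the span, so it contains only
      the zero matrix.\<close>
    then have "detects_below q n Q 0"
      unfolding detects_below_def Let_def
      by (auto simp: M.span_empty module_mat_simps intro!: exI[of _ 0])
    \<comment> \<open>\<open>GREATEST\<close> is meaningful here: 0 is admissible and all admissible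
      \<open>d\<close> are bounded by \<open>bd\<close>.\<close>
    then have "detects_below q n Q (GREATEST d. detects_below q n Q d)"
    proof (rule GreatestI_nat)
      show "d \<le> nat \<lfloor>\<beta> * real n\<rfloor>" if "detects_below q n Q d" for d
        using bd[OF that] by (simp add: le_nat_floor)
    qed
    then show ?thesis using bd True by (simp add: min_distance_def)
  next
    case False
    have bd: "real d \<le> \<beta> * real n" if "uniform_below q n Q d" for d
      using main[OF n code] False that by auto
    have "uniform_below q n Q 0" by (simp add: uniform_below_def)
    then have "uniform_below q n Q (GREATEST d. uniform_below q n Q d)"
    proof (rule GreatestI_nat)
      show "d \<le> nat \<lfloor>\<beta> * real n\<rfloor>" if "uniform_below q n Q d" for d
        using bd[OF that] by (simp add: le_nat_floor)
    qed
    then show ?thesis using bd False by (simp add: min_distance_def)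
  qed
  then show ?thesis using that unfolding \<beta>_def S_def by blast
qed

theorem theorem9:
  fixes q :: nat and n K :: "nat \<Rightarrow> nat" and Q :: "nat \<Rightarrow> complex vec set"
  assumes "q \<ge> 2"
    and "\<And>i. quantum_code q (n i) (K i) (Q i)"
    and "filterlim n at_top sequentially"
  shows "limsup (\<lambda>i. ereal (real (min_distance q (n i) (Q i)) / real (n i)))
           \<le> ereal (1 / 2 * (1 - 1 / (real q)\<^sup>2))"
proof (rule ereal_le_epsilon2)
  fix \<epsilon> :: real assume "0 < \<epsilon>"
  then obtain N where N: "\<And>n K Q. n \<ge> N \<Longrightarrow> quantum_code q n K Q \<Longrightarrow>
      real (min_distance q n Q) \<le> (1 / 2 * (1 - 1 / (real q)\<^sup>2) + \<epsilon>) * real n"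
    using distance_bound[OF assms(1)] by blast
  \<comment> \<open>The maximum with 1 makes \<open>n i\<close> positive for the division.\<close>
  have "\<forall>\<^sub>F i in sequentially. n i \<ge> max N 1"
    using assms(3) unfolding filterlim_at_top by blast
  then have "\<forall>\<^sub>F i in sequentially. ereal (real (min_distance q (n i) (Q i)) / real (n i)) \<le>
      ereal (1 / 2 * (1 - 1 / (real q)\<^sup>2) + \<epsilon>)"
  proof eventually_elim
    case (elim i)
    then show ?case using N[OF _ assms(2), of i] by (simp add: divide_le_eq)
  qed
  then have "limsup (\<lambda>i. ereal (real (min_distance q (n i) (Q i)) / real (n i))) \<le>
      ereal (1 / 2 * (1 - 1 / (real q)\<^sup>2) + \<epsilon>)"
    by (rule Limsup_bounded)
  then show "limsup (\<lambda>i. ereal (real (min_distance q (n i) (Q i)) / real (n i)))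
      \<le> ereal (1 / 2 * (1 - 1 / (real q)\<^sup>2)) + ereal \<epsilon>" by simp
qed

end
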